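(* Let $T\subset\mathbb{R}^3$ be a nondegenerate (closed) triangle with vertices $\boldsymbol p_1,\boldsymbol p_2,\boldsymbol p_3$, with unit normal $\hat{\boldsymbol n}=\hat{\boldsymbol w}$, and consider an arbitrary dipolar source with position $\boldsymbol r_0\in\mathbb{R}^3\setminus T$ and moment $\boldsymbol q\in\mathbb{R}^3$. Let $f(\boldsymbol r)=\boldsymbol q\cdot\boldsymbol R/R^3$ with $\boldsymbol R=\boldsymbol r-\boldsymbol r_0$, $R=|\boldsymbol R|$. Let $\boldsymbol\varphi=[\varphi_1,\varphi_2,\varphi_3]^T$ be the vector of linear interpolation functions on $T$ ($\varphi_i$ affine on the plane of $T$ and $\varphi_i(\boldsymbol p_j)=\delta_{ij}$), and define the surface element source vector $$\boldsymbol b^s=\frac{1}{4\pi}\int_T\boldsymbol\varphi(\boldsymbol r)\,\langle\nabla f(\boldsymbol r),\hat{\boldsymbol n}\rangle\,d\boldsymbol r\in\mathbb{R}^3 .$$ Then, with the notation of the context, $$4\pi\,\boldsymbol b^s=\boldsymbol\varphi(u_0,v_0)\,I_0+\begin{bmatrix}-s_3^{-1} & (u_3s_3^{-1}-1)v_3^{-1}\\ s_3^{-1} & -u_3s_3^{-1}v_3^{-1}\\ 0 & v_3^{-1}\end{bmatrix}\begin{bmatrix}I_u^a\\ I_v^a\end{bmatrix},$$ where $$I_0=\int_T\hat{\boldsymbol n}\cdot\nabla f\,d\boldsymbol r,\qquad I_u^a=\int_T u_a\,\hat{\boldsymbol n}\cdot\nabla f\,d\boldsymbol r,\qquad I_v^a=\int_T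 v_a\,\hat{\boldsymbol n}\cdot\nabla f\,d\boldsymbol r,$$ and these integrals are given in closed form by $$I_0=\boldsymbol q\cdot\sum_{i=1}^3R_i^s\left(w_0\hat{\boldsymbol m}_i-t_i^0\hat{\boldsymbol w}\right),$$ $$I_u^a=\boldsymbol q\cdot\Big[w_0\sum_{i=1}^3\hat{\boldsymbol m}_i\ \hat{\boldsymbol u}\cdot\left(\hat{\boldsymbol s}_iR_i^d+\boldsymbol t_i^0R_i^s\right)-\hat{\boldsymbol u}\,\mathrm{sgn}(w_0)\,\beta+\hat{\boldsymbol w}\Big(\hat{\boldsymbol u}\cdot\sum_{i=1}^3\hat{\boldsymbol m}_i\left(R_i^sw_0^2-f_{2i}\right)\Big)\Big],$$ $$I_v^a=\boldsymbol q\cdot\Big[w_0\sum_{i=1}^3\hat{\boldsymbol m}_i\ \hat{\boldsymbol v}\cdot\left(\hat{\boldsymbol s}_iR_i^d+\boldsymbol t_i^0R_i^s\right)-\hat{\boldsymbol v}\,\mathrm{sgn}(w_0)\,\beta+\hat{\boldsymbol w}\Big(\hat{\boldsymbol v}\cdot\sum_{i=1}^3\hat{\boldsymbol m}_i\left(R_i^sw_0^2-f_{2i}\right)\Big)\Big].$$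
   Context: Indices of vertices are cyclic: $\boldsymbol p_4=\boldsymbol p_1$, $\boldsymbol p_0=\boldsymbol p_3$. Side vectors: $\boldsymbol s_i=\boldsymbol p_{i-1}-\boldsymbol p_{i+1}$, $s_i=|\boldsymbol s_i|$, $\hat{\boldsymbol s}_i=\boldsymbol s_i/s_i$ ($i=1,2,3$), so $\boldsymbol s_1=\boldsymbol p_3-\boldsymbol p_2$, $\boldsymbol s_2=\boldsymbol p_1-\boldsymbol p_3$, $\boldsymbol s_3=\boldsymbol p_2-\boldsymbol p_1$. Local orthonormal frame with origin $\boldsymbol p_1$: $\hat{\boldsymbol u}=\hat{\boldsymbol s}_3$, $\hat{\boldsymbol w}=(\hat{\boldsymbol s}_1\times\hat{\boldsymbol s}_2)/|\hat{\boldsymbol s}_1\times\hat{\boldsymbol s}_2|$, $\hat{\boldsymbol v}=\hat{\boldsymbol w}\times\hat{\boldsymbol u}$. A point of the plane of $T$ is written $\boldsymbol p_1+u\hat{\boldsymbol u}+v\hat{\boldsymbol v}$, with coordinates $[u,v]$; thus $\boldsymbol p_1=[0,0]$, $\boldsymbol p_2=[s_3,0]$, $\boldsymbol p_3=[u_3,v_3]$ with $u_3=-\boldsymbol s_2\cdot\hat{\boldsymbol u}$, $v_3=-\boldsymbol s_2\cdot\hat{\boldsymbol v}$. In these coordinates $$\boldsymbol\varphi(u,v)=\begin{bmatrix}1&-s_3^{-1}&(u_3s_3^{-1}-1)v_3^{-1}\\ 0&s_3^{-1}&-u_3s_3^{-1}v_3^{-1}\\ 0&0&v_3^{-1}\end{bmatrix}\begin{bmatrix}1\\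 u\\ v\end{bmatrix},$$ and this expression is used for all $(u,v)\in\mathbb{R}^2$ (also outside $T$). The source position is written $\boldsymbol r_0=\boldsymbol\rho-w_0\hat{\boldsymbol w}$, where $\boldsymbol\rho=\boldsymbol p_1+u_0\hat{\boldsymbol u}+v_0\hat{\boldsymbol v}$ is the orthogonal projection of $\boldsymbol r_0$ onto the plane of $T$ and $w_0\in\mathbb{R}$. Translated coordinates: $u_a=u-u_0$, $v_a=v-v_0$, so that on $T$, $\boldsymbol R=u_a\hat{\boldsymbol u}+v_a\hat{\boldsymbol v}+w_0\hat{\boldsymbol w}$. For $i=1,2,3$: $\hat{\boldsymbol m}_i=\hat{\boldsymbol s}_i\times\hat{\boldsymbol w}$; $\boldsymbol t_i^0=t_i^0\hat{\boldsymbol m}_i$ with $t_1^0=[v_0(u_3-s_3)+v_3(s_3-u_0)]/s_1$, $t_2^0=(u_0v_3-v_0u_3)/s_2$, $t_3^0=v_0$. The points of side $i$ (the side opposite to $\boldsymbol p_i$) are $\boldsymbol\rho+\boldsymbol t_i^0+s\hat{\boldsymbol s}_i$, $s\in[s_i^-,s_i^+]$, with $s_1^-=-[(s_3-u_0)(s_3-u_3)+v_0v_3]/s_1$, $s_1^+=[(u_3-u_0)(u_3-s_3)+v_3(v_3-v_0)]/s_1$, $s_2^-=-[u_3(u_3-u_0)+v_3(v_3-v_0)]/s_2$, $s_2^+=(u_0u_3+v_0v_3)/s_2$, $s_3^-=-u_0$, $s_3^+=s_3-u_0$. Furthermore, $R_i^0=\sqrt{(t_i^0)^2+w_0^2}$,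 $R_i^\pm=\sqrt{(s_i^\pm)^2+(t_i^0)^2+w_0^2}$, $$f_{2i}=\ln\frac{R_i^++s_i^+}{R_i^-+s_i^-},\quad R_i^s=\frac{1}{(R_i^0)^2}\left(\frac{s_i^+}{R_i^+}-\frac{s_i^-}{R_i^-}\right),\quad R_i^d=\frac1{R_i^-}-\frac1{R_i^+},$$ $$\beta_i=\tan^{-1}\frac{t_i^0s_i^+}{(R_i^0)^2+|w_0|R_i^+}-\tan^{-1}\frac{t_i^0s_i^-}{(R_i^0)^2+|w_0|R_i^-},\qquad \beta=\beta_1+\beta_2+\beta_3,$$ with $\tan^{-1}$ evaluated on its principal branch. $\mathrm{sgn}$ is the sign function. Integrals over $T$ are with respect to surface area, and $\nabla$ is the gradient in $\mathbb{R}^3$ with respect to $\boldsymbol r$.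
   Formalization: When the source lies on the line through side i with s_i^- and s_i^+ negative, f_{2i} as written is ln(0/0); it is given its limit ln(s_i^-/s_i^+) there. R_i^s and beta_i, also 0/0 when R_i^0=0, count as finite there and occur only with factor 0. *)

theory Defs
  imports "HOL-Analysis.Analysis"
begin

section \<open>Gradient, surface integrals, affine functions\<close>

definition grad :: "(real^3 \<Rightarrow> real) \<Rightarrow> real^3 \<Rightarrow> real^3" where
  "grad f x = (THE D. GDERIV f x :> D)"

definition affine_fun_on :: "(real^3) set \<Rightarrow> (real^3 \<Rightarrow> real) \<Rightarrow> bool" where
  "affine_fun_on S f \<longleftrightarrow>
     (\<forall>x\<in>S. \<forall>y\<in>S. \<forall>t. f ((1 - t) *\<^sub>R x + t *\<^sub>R y) = (1 - t) * f x + t * f y)"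

text \<open>Integral with respect to surface area over the surface parametrized by \<open>\<sigma>\<close> on \<open>D\<close>.\<close>

definition surface_integral ::
    "(real \<times> real \<Rightarrow> real^3) \<Rightarrow> (real \<times> real) set \<Rightarrow> (real^3 \<Rightarrow> 'b) \<Rightarrow> 'b::{banach, second_countable_topology}" where
  "surface_integral \<sigma> D g =
     (LINT x:D|lborel.
        norm (cross3 (frechet_derivative \<sigma> (at x) (1, 0)) (frechet_derivative \<sigma> (at x) (0, 1)))
          *\<^sub>R g (\<sigma> x))"

section \<open>The triangle\<close>

text \<open>
  The vertices are indexed by the type \<open>3\<close> of residues modulo 3, whose elements are 1, 2 and
  3 = 0.  Index arithmetic in this type is the cyclic one: 3 + 1 = 1 and 1 - 1 = 3.
\<close>

definition triangle :: "(3 \<Rightarrow> real^3) \<Rightarrow> (real^3) set" where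
  "triangle p = convex hull {p 1, p 2, p 3}"

definition ref_triangle :: "(real \<times> real) set" where
  "ref_triangle = {(a, b). 0 \<le> a \<and> 0 \<le> b \<and> a + b \<le> 1}"

definition triangle_param :: "(3 \<Rightarrow> real^3) \<Rightarrow> real \<times> real \<Rightarrow> real^3" where
  "triangle_param p = (\<lambda>(a, b). p 1 + a *\<^sub>R (p 2 - p 1) + b *\<^sub>R (p 3 - p 1))"

lemma triangle_param_image: "triangle_param p ` ref_triangle = triangle p"
proof -
  have *: "triangle_param p (a, b) = (1 - a - b) *\<^sub>R p 1 + a *\<^sub>R p 2 + b *\<^sub>R p 3" for a b
    by (simp add: triangle_param_def algebra_simps)
  show ?thesis
    unfolding triangle_def convex_hull_3
  proof (intro equalityI subsetI)
    fix x assume "x \<in> triangle_param p ` ref_triangle"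
    then obtain a b where ab: "0 \<le> a" "0 \<le> b" "a + b \<le> 1" "x = triangle_param p (a, b)"
      by (auto simp: ref_triangle_def)
    then have "0 \<le> 1 - a - b \<and> 0 \<le> a \<and> 0 \<le> b \<and> (1 - a - b) + a + b = 1 \<and>
        x = (1 - a - b) *\<^sub>R p 1 + a *\<^sub>R p 2 + b *\<^sub>R p 3"
      by (simp add: *)
    then show "x \<in> {u *\<^sub>R p 1 + v *\<^sub>R p 2 + w *\<^sub>R p 3 | u v w. 0 \<le> u \<and> 0 \<le> v \<and> 0 \<le> w \<and> u + v + w = 1}"
      by blast
  next
    fix x assume "x \<in> {u *\<^sub>R p 1 + v *\<^sub>R p 2 + w *\<^sub>R p 3 | u v w. 0 \<le> u \<and> 0 \<le> v \<and> 0 \<le> w \<and> u + v + w = 1}"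
    then obtain u v w where uvw: "x = u *\<^sub>R p 1 + v *\<^sub>R p 2 + w *\<^sub>R p 3"
      "0 \<le> u" "0 \<le> v" "0 \<le> w" "u + v + w = 1" by blast
    then have "u = 1 - v - w" by simp
    then have "x = triangle_param p (v, w)" using uvw(1) by (simp add: *)
    moreover have "(v, w) \<in> ref_triangle" using uvw by (simp add: ref_triangle_def)
    ultimately show "x \<in> triangle_param p ` ref_triangle" by blast
  qed
qed

definition triangle_integral ::
    "(3 \<Rightarrow> real^3) \<Rightarrow> (real^3 \<Rightarrow> 'b) \<Rightarrow> 'b::{banach, second_countable_topology}" where
  "triangle_integral p g = surface_integral (triangle_param p) ref_triangle g"

definition side_vec :: "(3 \<Rightarrow> real^3) \<Rightarrow> 3 \<Rightarrow> real^3" where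
  "side_vec p i = p (i - 1) - p (i + 1)"

definition side_len :: "(3 \<Rightarrow> real^3) \<Rightarrow> 3 \<Rightarrow> real" where
  "side_len p i = norm (side_vec p i)"

definition s_hat :: "(3 \<Rightarrow> real^3) \<Rightarrow> 3 \<Rightarrow> real^3" where
  "s_hat p i = side_vec p i /\<^sub>R side_len p i"

definition u_hat :: "(3 \<Rightarrow> real^3) \<Rightarrow> real^3" where
  "u_hat p = s_hat p 3"

definition w_hat :: "(3 \<Rightarrow> real^3) \<Rightarrow> real^3" where
  "w_hat p = cross3 (s_hat p 1) (s_hat p 2) /\<^sub>R norm (cross3 (s_hat p 1) (s_hat p 2))"

definition v_hat :: "(3 \<Rightarrow> real^3) \<Rightarrow> real^3" where
  "v_hat p = cross3 (w_hat p) (u_hat p)"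

definition m_hat :: "(3 \<Rightarrow> real^3) \<Rightarrow> 3 \<Rightarrow> real^3" where
  "m_hat p i = cross3 (s_hat p i) (w_hat p)"

definition u_coord :: "(3 \<Rightarrow> real^3) \<Rightarrow> real^3 \<Rightarrow> real" where
  "u_coord p r = (r - p 1) \<bullet> u_hat p"

definition v_coord :: "(3 \<Rightarrow> real^3) \<Rightarrow> real^3 \<Rightarrow> real" where
  "v_coord p r = (r - p 1) \<bullet> v_hat p"

definition u3 :: "(3 \<Rightarrow> real^3) \<Rightarrow> real" where
  "u3 p = - (side_vec p 2 \<bullet> u_hat p)"

definition v3 :: "(3 \<Rightarrow> real^3) \<Rightarrow> real" where
  "v3 p = - (side_vec p 2 \<bullet> v_hat p)"

section \<open>Linear interpolation and the source vector\<close>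

definition linear_interpolation :: "(3 \<Rightarrow> real^3) \<Rightarrow> (real^3 \<Rightarrow> real^3) \<Rightarrow> bool" where
  "linear_interpolation p \<phi> \<longleftrightarrow>
     (\<forall>i. affine_fun_on (affine hull {p 1, p 2, p 3}) (\<lambda>r. \<phi> r $ i)) \<and>
     (\<forall>i j. \<phi> (p j) $ i = (if i = j then 1 else 0))"

definition phi_uv :: "(3 \<Rightarrow> real^3) \<Rightarrow> real \<Rightarrow> real \<Rightarrow> real^3" where
  "phi_uv p u v =
     (let s3 = side_len p 3; u3 = u3 p; v3 = v3 p in
      (vector [vector [1, - inverse s3, (u3 * inverse s3 - 1) * inverse v3],
               vector [0, inverse s3, - u3 * inverse s3 * inverse v3],
               vector [0, 0, inverse v3]] :: real^3^3) *v vector [1, u, v])"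

definition interp_matrix :: "(3 \<Rightarrow> real^3) \<Rightarrow> real^2^3" where
  "interp_matrix p =
     (let s3 = side_len p 3; u3 = u3 p; v3 = v3 p in
      vector [vector [- inverse s3, (u3 * inverse s3 - 1) * inverse v3],
              vector [inverse s3, - u3 * inverse s3 * inverse v3],
              vector [0, inverse v3]])"

definition dipole_potential :: "real^3 \<Rightarrow> real^3 \<Rightarrow> real^3 \<Rightarrow> real" where
  "dipole_potential q r0 r = (q \<bullet> (r - r0)) / norm (r - r0) ^ 3"

definition source_vector ::
    "(3 \<Rightarrow> real^3) \<Rightarrow> (real^3 \<Rightarrow> real^3) \<Rightarrow> real^3 \<Rightarrow> real^3 \<Rightarrow> real^3" where
  "source_vector p \<phi> q r0 =
     (1 / (4 * pi)) *\<^sub>R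
       triangle_integral p (\<lambda>r. (grad (dipole_potential q r0) r \<bullet> w_hat p) *\<^sub>R \<phi> r)"

section \<open>Quantities attached to a side\<close>

definition t0 :: "(3 \<Rightarrow> real^3) \<Rightarrow> real \<Rightarrow> real \<Rightarrow> 3 \<Rightarrow> real" where
  "t0 p u0 v0 i =
     (let s3 = side_len p 3; u3 = u3 p; v3 = v3 p in
      if i = 1 then (v0 * (u3 - s3) + v3 * (s3 - u0)) / side_len p 1
      else if i = 2 then (u0 * v3 - v0 * u3) / side_len p 2
      else v0)"

definition t0_vec :: "(3 \<Rightarrow> real^3) \<Rightarrow> real \<Rightarrow> real \<Rightarrow> 3 \<Rightarrow> real^3" where
  "t0_vec p u0 v0 i = t0 p u0 v0 i *\<^sub>R m_hat p i"

definition s_minus :: "(3 \<Rightarrow> real^3) \<Rightarrow> real \<Rightarrow> real \<Rightarrow> 3 \<Rightarrow> real" where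
  "s_minus p u0 v0 i =
     (let s3 = side_len p 3; u3 = u3 p; v3 = v3 p in
      if i = 1 then - ((s3 - u0) * (s3 - u3) + v0 * v3) / side_len p 1
      else if i = 2 then - (u3 * (u3 - u0) + v3 * (v3 - v0)) / side_len p 2
      else - u0)"

definition s_plus :: "(3 \<Rightarrow> real^3) \<Rightarrow> real \<Rightarrow> real \<Rightarrow> 3 \<Rightarrow> real" where
  "s_plus p u0 v0 i =
     (let s3 = side_len p 3; u3 = u3 p; v3 = v3 p in
      if i = 1 then ((u3 - u0) * (u3 - s3) + v3 * (v3 - v0)) / side_len p 1
      else if i = 2 then (u0 * u3 + v0 * v3) / side_len p 2
      else s3 - u0)"

definition R0 :: "(3 \<Rightarrow> real^3) \<Rightarrow> real \<Rightarrow> real \<Rightarrow> real \<Rightarrow> 3 \<Rightarrow> real" where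
  "R0 p u0 v0 w0 i = sqrt ((t0 p u0 v0 i)\<^sup>2 + w0\<^sup>2)"

definition R_plus :: "(3 \<Rightarrow> real^3) \<Rightarrow> real \<Rightarrow> real \<Rightarrow> real \<Rightarrow> 3 \<Rightarrow> real" where
  "R_plus p u0 v0 w0 i = sqrt ((s_plus p u0 v0 i)\<^sup>2 + (t0 p u0 v0 i)\<^sup>2 + w0\<^sup>2)"

definition R_minus :: "(3 \<Rightarrow> real^3) \<Rightarrow> real \<Rightarrow> real \<Rightarrow> real \<Rightarrow> 3 \<Rightarrow> real" where
  "R_minus p u0 v0 w0 i = sqrt ((s_minus p u0 v0 i)\<^sup>2 + (t0 p u0 v0 i)\<^sup>2 + w0\<^sup>2)"

text \<open>
  If \<open>R0 = 0\<close>, the source lies on the line through side \<open>i\<close> (but, being outside the triangle,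
  not on the side).  If moreover \<open>s_minus\<close> and \<open>s_plus\<close> are negative, the quotient in \<open>f2\<close> is 0/0,
  and \<open>f2\<close> denotes its limit as \<open>R0\<close> tends to 0; see \<open>f2_limit\<close> below.
\<close>

definition f2 :: "(3 \<Rightarrow> real^3) \<Rightarrow> real \<Rightarrow> real \<Rightarrow> real \<Rightarrow> 3 \<Rightarrow> real" where
  "f2 p u0 v0 w0 i =
     (let sp = s_plus p u0 v0 i; sm = s_minus p u0 v0 i;
          Rp = R_plus p u0 v0 w0 i; Rm = R_minus p u0 v0 w0 i in
      if Rm + sm = 0 then ln (sm / sp) else ln ((Rp + sp) / (Rm + sm)))"

lemma f2_limit:
  fixes sp sm :: real
  assumes "sm < sp" "sp < 0"
  shows "((\<lambda>h. ln ((sqrt (sp\<^sup>2 + h\<^sup>2) + sp) / (sqrt (sm\<^sup>2 + h\<^sup>2) + sm))) \<longlongrightarrow> ln (sm / sp)) (at 0)"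
proof -
  have conj: "sqrt (s\<^sup>2 + h\<^sup>2) + s = h\<^sup>2 / (sqrt (s\<^sup>2 + h\<^sup>2) - s)" if "s < 0" for s h :: real
  proof -
    have "sqrt (s\<^sup>2 + h\<^sup>2) - s > 0"
      using that real_sqrt_ge_zero[of "s\<^sup>2 + h\<^sup>2"] by (smt (verit) sum_power2_ge_zero)
    moreover have "(sqrt (s\<^sup>2 + h\<^sup>2) + s) * (sqrt (s\<^sup>2 + h\<^sup>2) - s) = h\<^sup>2"
      by (simp add: algebra_simps flip: power2_eq_square)
    ultimately show ?thesis by (simp add: field_simps)
  qed
  have "((\<lambda>h. ln ((sqrt (sm\<^sup>2 + h\<^sup>2) - sm) / (sqrt (sp\<^sup>2 + h\<^sup>2) - sp)))
      \<longlongrightarrow> ln ((sqrt (sm\<^sup>2 + 0\<^sup>2) - sm) / (sqrt (sp\<^sup>2 + 0\<^sup>2) - sp))) (at 0)"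
    using assms by (intro tendsto_intros) auto
  moreover have "ln ((sqrt (sm\<^sup>2 + 0\<^sup>2) - sm) / (sqrt (sp\<^sup>2 + 0\<^sup>2) - sp)) = ln (sm / sp)"
    using assms by (simp add: field_simps)
  moreover have "\<forall>\<^sub>F h in at 0. ln ((sqrt (sm\<^sup>2 + h\<^sup>2) - sm) / (sqrt (sp\<^sup>2 + h\<^sup>2) - sp)) =
      ln ((sqrt (sp\<^sup>2 + h\<^sup>2) + sp) / (sqrt (sm\<^sup>2 + h\<^sup>2) + sm))"
    unfolding eventually_at_filter
  proof (intro always_eventually allI impI)
    fix h :: real assume "h \<noteq> 0"
    have "sp < 0" "sm < 0" using assms by auto
    show "ln ((sqrt (sm\<^sup>2 + h\<^sup>2) - sm) / (sqrt (sp\<^sup>2 + h\<^sup>2) - sp)) =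
      ln ((sqrt (sp\<^sup>2 + h\<^sup>2) + sp) / (sqrt (sm\<^sup>2 + h\<^sup>2) + sm))"
      unfolding conj[OF \<open>sp < 0\<close>] conj[OF \<open>sm < 0\<close>] using \<open>h \<noteq> 0\<close> by simp
  qed
  ultimately show ?thesis by (simp add: tendsto_cong)
qed

text \<open>
  In the formulas below some quotients are 0/0 when \<open>R0 = 0\<close>, which forces \<open>t0 = w0 = 0\<close>.  Their
  value is then immaterial: \<open>Rs\<close> is used only multiplied by \<open>t0\<close> or \<open>w0\<close>, and \<open>beta\<close> only
  multiplied by \<open>sgn w0\<close>.
\<close>

definition Rs :: "(3 \<Rightarrow> real^3) \<Rightarrow> real \<Rightarrow> real \<Rightarrow> real \<Rightarrow> 3 \<Rightarrow> real" where
  "Rs p u0 v0 w0 i =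
     1 / (R0 p u0 v0 w0 i)\<^sup>2 *
       (s_plus p u0 v0 i / R_plus p u0 v0 w0 i - s_minus p u0 v0 i / R_minus p u0 v0 w0 i)"

definition Rd :: "(3 \<Rightarrow> real^3) \<Rightarrow> real \<Rightarrow> real \<Rightarrow> real \<Rightarrow> 3 \<Rightarrow> real" where
  "Rd p u0 v0 w0 i = 1 / R_minus p u0 v0 w0 i - 1 / R_plus p u0 v0 w0 i"

definition beta_side :: "(3 \<Rightarrow> real^3) \<Rightarrow> real \<Rightarrow> real \<Rightarrow> real \<Rightarrow> 3 \<Rightarrow> real" where
  "beta_side p u0 v0 w0 i =
     arctan (t0 p u0 v0 i * s_plus p u0 v0 i /
       ((R0 p u0 v0 w0 i)\<^sup>2 + \<bar>w0\<bar> * R_plus p u0 v0 w0 i)) -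
     arctan (t0 p u0 v0 i * s_minus p u0 v0 i /
       ((R0 p u0 v0 w0 i)\<^sup>2 + \<bar>w0\<bar> * R_minus p u0 v0 w0 i))"

definition beta :: "(3 \<Rightarrow> real^3) \<Rightarrow> real \<Rightarrow> real \<Rightarrow> real \<Rightarrow> real" where
  "beta p u0 v0 w0 = beta_side p u0 v0 w0 1 + beta_side p u0 v0 w0 2 + beta_side p u0 v0 w0 3"

end

theory Submission
  imports Defs
begin

text \<open>
  Write \<open>R = r - r0\<close>.  On the triangle the component of \<open>R\<close> along the normal \<open>w\<close> is the constant
  \<open>w0\<close>, so the normal derivative of the dipole potential is
  \<open>(q \<bullet> w) / norm R ^ 3 - 3 * w0 * (q \<bullet> R) / norm R ^ 5\<close> there.  This function and its two first
  moments are surface divergences of explicit tangential fields, up to a multiple of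
  \<open>1 / norm R ^ 3\<close> in the case of the moments.  With \<open>qt\<close> the tangential part of \<open>q\<close> and \<open>e\<close> a
  vector orthogonal to \<open>w\<close>, the function itself is the divergence of
  \<open>(w0 / norm R ^ 3) qt - ((q \<bullet> w) / norm R ^ 3) Rt\<close>, where \<open>Rt\<close> is the tangential part of \<open>R\<close>,
  and its product with \<open>R \<bullet> e\<close> is the divergence of
  \<open>(w0 * (R \<bullet> e) / norm R ^ 3) qt + (q \<bullet> w) * (w0\<^sup>2 / norm R ^ 3 - 1 / norm R) e\<close>
  minus \<open>(q \<bullet> e) * w0 / norm R ^ 3\<close>.  The last term, the solid angle density, is for \<open>w0 \<noteq> 0\<close> the
  multiple \<open>(q \<bullet> e) * sgn w0\<close> of the divergence of \<open>Rt / (norm R * (norm R + \<bar>w0\<bar>))\<close>.  The summand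
  \<open>\<bar>w0\<bar>\<close> keeps this field smooth at the foot of the perpendicular from the source, which may lie in
  the triangle; that is why the arctangents add up without branch corrections.

  The divergence theorem on a triangle (\<open>triangle_divergence\<close>) turns everything into integrals
  along the sides.  On side \<open>i\<close> the vector \<open>R\<close> is \<open>s s_hat + t m + w0 w\<close> with \<open>s\<close> running from
  \<open>s_minus\<close> to \<open>s_plus\<close> and \<open>t\<close>, \<open>w0\<close> constant (\<open>side_point\<close>), so these are one-variable integrals
  with elementary primitives: they produce \<open>Rs\<close>, \<open>Rd\<close>, \<open>f2\<close> and \<open>beta_side\<close>.

  The exceptional positions of the source fit into these formulas.  A source in the plane of
  the triangle makes the solid angle term vanish, and a source on the line through a side makes
  \<open>t = w0 = 0\<close> for that side, where \<open>Rs\<close> occurs only with a factor \<open>t\<close> or \<open>w0\<close>.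

  The formula for the source vector follows because \<open>\<phi>\<close> agrees on the triangle with an affine
  function of the two translated coordinates (\<open>interpolation_uv\<close>).
\<close>

section \<open>Integration over the reference triangle\<close>

lemma set_integral_FTC:
  fixes f F :: "real \<Rightarrow> real"
  assumes "a \<le> b"
    and deriv: "\<And>x. x \<in> {a..b} \<Longrightarrow> (F has_real_derivative f x) (at x)"
    and cont: "continuous_on {a..b} f"
  shows "(LINT x:{a..b}|lborel. f x) = F b - F a"
  unfolding set_lebesgue_integral_def
proof (rule integral_FTC_Icc[OF \<open>a \<le> b\<close> _ cont])
  fix x assume "a \<le> x" "x \<le> b"
  then show "(F has_vector_derivative f x) (at x within {a..b})"
    using deriv[of x]
    by (simp add: has_real_derivative_iff_has_vector_derivative has_vector_derivative_at_within)
qed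

lemma set_integral_reflect:
  fixes f :: "real \<Rightarrow> real"
  shows "(LINT t:{0..1}|lborel. f (1 - t)) = (LINT t:{0..1}|lborel. f t)"
proof -
  have "(LINT t:{0..1}|lborel. f t) =
      (\<integral>t. indicator {0..1} (1 + (- 1) * t) *\<^sub>R f (1 + (- 1) * t) \<partial>lborel)"
    unfolding set_lebesgue_integral_def by (subst lborel_integral_real_affine[of "- 1" _ 1]) auto
  also have "\<dots> = (LINT t:{0..1}|lborel. f (1 - t))"
    unfolding set_lebesgue_integral_def
    by (intro Bochner_Integration.integral_cong) (auto simp: indicator_def)
  finally show ?thesis by simp
qed

lemma compact_ref_triangle: "compact ref_triangle"
proof -
  have "closed ref_triangle"
    unfolding ref_triangle_def case_prod_beta
    by (intro closed_Collect_conj closed_Collect_le continuous_intros)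
  moreover have "ref_triangle \<subseteq> cbox (0, 0) (1, 1)"
    by (auto simp: ref_triangle_def)
  then have "bounded ref_triangle" using bounded_cbox bounded_subset by blast
  ultimately show ?thesis by (simp add: compact_eq_bounded_closed)
qed

lemma ref_triangle_integral_slices:
  fixes f :: "real \<times> real \<Rightarrow> real"
  assumes "continuous_on ref_triangle f"
  shows "(LINT x:ref_triangle|lborel. f x) =
      (LINT a:{0..1}|lborel. LINT b:{0..1-a}|lborel. f (a, b))" (is ?vertical)
    and "(LINT x:ref_triangle|lborel. f x) =
      (LINT b:{0..1}|lborel. LINT a:{0..1-b}|lborel. f (a, b))" (is ?horizontal)
proof -
  define g where "g = (\<lambda>x. indicator ref_triangle x *\<^sub>R f x)"
  have int: "integrable (lborel \<Otimes>\<^sub>M lborel) g"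
    using borel_integrable_compact[OF compact_ref_triangle assms] by (simp add: lborel_prod g_def)
  have int': "integrable (lborel \<Otimes>\<^sub>M lborel) (case_prod (\<lambda>a b. g (a, b)))"
    using int by simp
  have total: "(LINT x:ref_triangle|lborel. f x) = integral\<^sup>L (lborel \<Otimes>\<^sub>M lborel) g"
    by (simp add: lborel_prod g_def set_lebesgue_integral_def)
  have "(LINT b|lborel. g (a, b)) = indicator {0..1} a *\<^sub>R (LINT b:{0..1-a}|lborel. f (a, b))" for a
    unfolding set_lebesgue_integral_def g_def integral_scaleR_right[symmetric]
    by (intro Bochner_Integration.integral_cong) (auto simp: indicator_def ref_triangle_def)
  then show ?vertical
    using lborel_pair.integral_fst'[OF int] unfolding total by (simp add: set_lebesgue_integral_def)
  have "(LINT a|lborel. g (a, b)) = indicator {0..1} b *\<^sub>R (LINT a:{0..1-b}|lborel. f (a, b))" for b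
    unfolding set_lebesgue_integral_def g_def integral_scaleR_right[symmetric]
    by (intro Bochner_Integration.integral_cong) (auto simp: indicator_def ref_triangle_def)
  then show ?horizontal
    using lborel_pair.integral_snd[OF int'] unfolding total by (simp add: set_lebesgue_integral_def)
qed

section \<open>The orthonormal frames of a triangle\<close>

lemma cross_orthonormal:
  fixes u w :: "real^3"
  assumes "u \<bullet> u = 1" "w \<bullet> w = 1" "u \<bullet> w = 0"
  shows "cross3 w u \<bullet> cross3 w u = 1" "cross3 w u \<bullet> u = 0" "cross3 w u \<bullet> w = 0"
    "cross3 u w = - cross3 w u" "cross3 (cross3 w u) w = u"
proof -
  show "cross3 w u \<bullet> cross3 w u = 1"
    using norm_cross_dot[of w u] assms
    by (simp add: dot_square_norm power_mult_distrib inner_commute)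
  show "cross3 w u \<bullet> u = 0" "cross3 w u \<bullet> w = 0" by (simp_all add: dot_cross_self)
  show "cross3 u w = - cross3 w u" by (rule cross_skew)
  show "cross3 (cross3 w u) w = u"
    using Lagrange[of w w u] assms cross_skew[of "cross3 w u" w] by (simp add: inner_commute)
qed

text \<open>
  The remainder \<open>d\<close> of the expansion is orthogonal to all three vectors.  By the triple product
  expansion of \<open>d \<times> (w \<times> u)\<close> it is then also parallel to \<open>w \<times> u\<close>, hence zero.
\<close>

lemma frame_expansion:
  fixes u w x :: "real^3"
  assumes "u \<bullet> u = 1" "w \<bullet> w = 1" "u \<bullet> w = 0"
  shows "x = (x \<bullet> u) *\<^sub>R u + (x \<bullet> cross3 w u) *\<^sub>R cross3 w u + (x \<bullet> w) *\<^sub>R w"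
proof -
  define v where "v = cross3 w u"
  note v = cross_orthonormal[OF assms, folded v_def]
  define d where "d = x - (x \<bullet> u) *\<^sub>R u - (x \<bullet> v) *\<^sub>R v - (x \<bullet> w) *\<^sub>R w"
  have d: "d \<bullet> u = 0" "d \<bullet> v = 0" "d \<bullet> w = 0"
    using v assms by (simp_all add: d_def inner_diff_right inner_diff_left inner_commute)
  have "cross3 d v = 0"
    unfolding v_def using Lagrange[of d w u] d by simp
  then have "d = 0 \<or> v = 0" using norm_and_cross_eq_0[of d v] d by simp
  moreover have "v \<noteq> 0" using v(1) by auto
  ultimately show ?thesis by (simp add: d_def v_def algebra_simps)
qed

lemma frame_inner:
  fixes u w x y :: "real^3"
  assumes "u \<bullet> u = 1" "w \<bullet> w = 1" "u \<bullet> w = 0"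
  shows "x \<bullet> y = (x \<bullet> u) * (y \<bullet> u) + (x \<bullet> cross3 w u) * (y \<bullet> cross3 w u) + (x \<bullet> w) * (y \<bullet> w)"
proof -
  have "x \<bullet> y = ((x \<bullet> u) *\<^sub>R u + (x \<bullet> cross3 w u) *\<^sub>R cross3 w u + (x \<bullet> w) *\<^sub>R w) \<bullet> y"
    using frame_expansion[OF assms, of x] by simp
  then show ?thesis by (simp add: inner_add_left inner_commute[of y])
qed

lemma cyclic_index: "(1::3) - 1 = 3" "(2::3) - 1 = 1" "(3::3) - 1 = 2"
  "(1::3) + 1 = 2" "(2::3) + 1 = 3" "(3::3) + 1 = 1"
  by simp_all

lemma side_vec_expand: "side_vec p 1 = p 3 - p 2" "side_vec p 2 = p 1 - p 3" "side_vec p 3 = p 2 - p 1"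
  unfolding side_vec_def cyclic_index by (rule refl)+

locale triangle_frame =
  fixes p :: "3 \<Rightarrow> real^3"
  assumes nondegenerate: "\<not> collinear {p 1, p 2, p 3}"
begin

abbreviation "u \<equiv> u_hat p"
abbreviation "v \<equiv> v_hat p"
abbreviation "w \<equiv> w_hat p"
abbreviation "l \<equiv> side_len p"

lemma normal_nonzero: "cross3 (p 2 - p 1) (p 3 - p 1) \<noteq> 0"
proof -
  have "{p 1, p 2, p 3} = {p 2, p 1, p 3}" by auto
  then have "\<not> collinear {0, p 2 - p 1, p 3 - p 1}"
    using nondegenerate by (subst collinear_3[symmetric]) (simp_all add: NO_MATCH_def)
  then show ?thesis by (simp add: cross_eq_0)
qed

lemma side_len_pos: "l i > 0"
proof -
  have "side_vec p 1 \<noteq> 0" "side_vec p 2 \<noteq> 0" "side_vec p 3 \<noteq> 0"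
    using normal_nonzero by (auto simp: side_vec_expand)
  then have "side_vec p i \<noteq> 0" using exhaust_3[of i] by auto
  then show ?thesis by (simp add: side_len_def)
qed

lemma side_vec_hat: "side_vec p i = l i *\<^sub>R s_hat p i"
  using side_len_pos[of i] by (simp add: s_hat_def)

lemma normal_direction:
  "cross3 (p 2 - p 1) (p 3 - p 1) = norm (cross3 (p 2 - p 1) (p 3 - p 1)) *\<^sub>R w"
proof -
  let ?n = "cross3 (p 2 - p 1) (p 3 - p 1)"
  have "cross3 (side_vec p 1) (side_vec p 2) = cross3 ((p 3 - p 1) - (p 2 - p 1)) (- (p 3 - p 1))"
    by (simp add: side_vec_expand)
  also have "\<dots> = ?n"
    by (simp only: cross_minus_right Cross3.left_diff_distrib cross_refl) simp
  finally have "cross3 (s_hat p 1) (s_hat p 2) = inverse (l 1 * l 2) *\<^sub>R ?n"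
    by (simp add: s_hat_def cross_mult_left cross_mult_right)
  then have "w = ?n /\<^sub>R norm ?n"
    using side_len_pos[of 1] side_len_pos[of 2] by (simp add: w_hat_def abs_mult field_simps)
  then show ?thesis using normal_nonzero by simp
qed

lemma w_unit: "w \<bullet> w = 1"
proof -
  let ?n = "cross3 (p 2 - p 1) (p 3 - p 1)"
  have "norm ?n = norm ?n * norm w"
    using arg_cong[OF normal_direction, of norm] unfolding norm_scaleR by simp
  then show ?thesis using normal_nonzero by (simp add: dot_square_norm)
qed

lemma side_vec_w: "side_vec p i \<bullet> w = 0"
proof -
  let ?n = "cross3 (p 2 - p 1) (p 3 - p 1)"
  have "(p 2 - p 1) \<bullet> ?n = 0" "(p 3 - p 1) \<bullet> ?n = 0" by (simp_all add: dot_cross_self)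
  then have "norm ?n * ((p 2 - p 1) \<bullet> w) = 0" "norm ?n * ((p 3 - p 1) \<bullet> w) = 0"
    unfolding inner_scaleR_right[symmetric] normal_direction[symmetric] .
  then have "(p 2 - p 1) \<bullet> w = 0" "(p 3 - p 1) \<bullet> w = 0"
    using normal_nonzero by simp_all
  then show ?thesis
    using exhaust_3[of i] by (auto simp: side_vec_expand inner_diff_left)
qed

lemma s_hat_frame: "s_hat p i \<bullet> s_hat p i = 1" "w \<bullet> w = 1" "s_hat p i \<bullet> w = 0"
proof -
  have "norm (s_hat p i) = 1"
    using side_len_pos[of i] by (simp add: s_hat_def side_len_def)
  then show "s_hat p i \<bullet> s_hat p i = 1" by (simp add: dot_square_norm)
qed (simp_all add: w_unit s_hat_def side_vec_w)

lemma uw_frame: "u \<bullet> u = 1" "w \<bullet> w = 1" "u \<bullet> w = 0"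
  unfolding u_hat_def by (rule s_hat_frame)+

lemmas v_facts = cross_orthonormal[OF uw_frame, folded v_hat_def]

lemma m_hat_eq: "m_hat p i = - cross3 w (s_hat p i)"
  unfolding m_hat_def by (rule cross_skew)

lemma m_hat_facts: "m_hat p i \<bullet> m_hat p i = 1" "m_hat p i \<bullet> s_hat p i = 0" "m_hat p i \<bullet> w = 0"
  using cross_orthonormal[OF s_hat_frame, of i] by (simp_all add: m_hat_eq)

lemma uvw_expansion: "x = (x \<bullet> u) *\<^sub>R u + (x \<bullet> v) *\<^sub>R v + (x \<bullet> w) *\<^sub>R w"
  unfolding v_hat_def by (rule frame_expansion[OF uw_frame])

lemma uvw_inner: "x \<bullet> y = (x \<bullet> u) * (y \<bullet> u) + (x \<bullet> v) * (y \<bullet> v) + (x \<bullet> w) * (y \<bullet> w)"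
  unfolding v_hat_def by (rule frame_inner[OF uw_frame])

lemma smw_expansion: "x = (x \<bullet> s_hat p i) *\<^sub>R s_hat p i + (x \<bullet> m_hat p i) *\<^sub>R m_hat p i + (x \<bullet> w) *\<^sub>R w"
  using frame_expansion[OF s_hat_frame, of x i] by (simp add: m_hat_eq)

lemma side_vec_uv:
  "side_vec p 1 = (u3 p - l 3) *\<^sub>R u + v3 p *\<^sub>R v"
  "side_vec p 2 = - (u3 p *\<^sub>R u + v3 p *\<^sub>R v)"
  "side_vec p 3 = l 3 *\<^sub>R u"
proof -
  show 3: "side_vec p 3 = l 3 *\<^sub>R u" by (simp add: u_hat_def flip: side_vec_hat)
  show 2: "side_vec p 2 = - (u3 p *\<^sub>R u + v3 p *\<^sub>R v)"
    using uvw_expansion[of "side_vec p 2"] by (simp add: u3_def v3_def side_vec_w add.commute)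
  have "side_vec p 1 = - side_vec p 2 - side_vec p 3" by (simp add: side_vec_expand)
  then show "side_vec p 1 = (u3 p - l 3) *\<^sub>R u + v3 p *\<^sub>R v"
    unfolding 2 3 by (simp add: algebra_simps)
qed

text \<open>
  This number is the constant Jacobian of \<open>triangle_param\<close>.
\<close>

lemma area_factor: "norm (cross3 (p 2 - p 1) (p 3 - p 1)) = l 3 * v3 p"
proof -
  let ?J = "norm (cross3 (p 2 - p 1) (p 3 - p 1))"
  have "?J *\<^sub>R w = cross3 (side_vec p 3) (- side_vec p 2)"
    unfolding normal_direction[symmetric] by (simp add: side_vec_expand)
  also have "\<dots> = (l 3 * v3 p) *\<^sub>R cross3 u v"
    unfolding side_vec_uv by (simp add: cross_add_right cross_mult_left cross_mult_right)
  also have "cross3 u v = w"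
    unfolding v_hat_def Lagrange using uw_frame by (simp add: inner_commute)
  finally have "?J *\<^sub>R w = (l 3 * v3 p) *\<^sub>R w" .
  then show ?thesis using w_unit by auto
qed

lemma v3_pos: "v3 p > 0"
  using area_factor normal_nonzero side_len_pos[of 3]
  by (metis zero_less_mult_pos zero_less_norm_iff)

lemma m_hat_uv:
  "l 1 *\<^sub>R m_hat p 1 = v3 p *\<^sub>R u - (u3 p - l 3) *\<^sub>R v"
  "l 2 *\<^sub>R m_hat p 2 = u3 p *\<^sub>R v - v3 p *\<^sub>R u"
  "l 3 *\<^sub>R m_hat p 3 = - (l 3 *\<^sub>R v)"
proof -
  have M: "l i *\<^sub>R m_hat p i = cross3 (side_vec p i) w" for i
    by (simp add: side_vec_hat m_hat_def cross_mult_left)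
  show "l 1 *\<^sub>R m_hat p 1 = v3 p *\<^sub>R u - (u3 p - l 3) *\<^sub>R v"
    "l 2 *\<^sub>R m_hat p 2 = u3 p *\<^sub>R v - v3 p *\<^sub>R u"
    "l 3 *\<^sub>R m_hat p 3 = - (l 3 *\<^sub>R v)"
    unfolding M side_vec_uv
    by (simp_all add: v_facts cross_add_left cross_mult_left Cross3.left_diff_distrib)
qed

text \<open>
  This expresses a tangential direction in the edge basis of the parametrization.  Up to the area
  factor, the coefficients are components along the outward normals of the sides; this is how the normals
  enter the divergence theorem.
\<close>

lemma tangent_decomposition:
  assumes "d \<bullet> w = 0"
  shows "(l 3 * v3 p) *\<^sub>R d =
    - ((d \<bullet> (l 2 *\<^sub>R m_hat p 2)) *\<^sub>R (p 2 - p 1)) - (d \<bullet> (l 3 *\<^sub>R m_hat p 3)) *\<^sub>R (p 3 - p 1)"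
proof -
  have pv: "p 2 - p 1 = side_vec p 3" "p 3 - p 1 = - side_vec p 2" by (simp_all add: side_vec_expand)
  have "d = (d \<bullet> u) *\<^sub>R u + (d \<bullet> v) *\<^sub>R v" using uvw_expansion[of d] assms by simp
  then have "(l 3 * v3 p) *\<^sub>R d = (l 3 * v3 p) *\<^sub>R ((d \<bullet> u) *\<^sub>R u + (d \<bullet> v) *\<^sub>R v)" by simp
  then show ?thesis
    unfolding pv m_hat_uv side_vec_uv by (simp add: algebra_simps)
qed

text \<open>
  The side vectors, and hence their images under rotation by a right angle, add up to zero.
\<close>

lemma m_hat_sum: "l 1 *\<^sub>R m_hat p 1 = - (l 2 *\<^sub>R m_hat p 2) - l 3 *\<^sub>R m_hat p 3"
  unfolding m_hat_uv by (simp add: algebra_simps)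


end

section \<open>The divergence theorem on a triangle\<close>

text \<open>
  The side is traversed from \<open>p (i + 1)\<close> to \<open>p (i - 1)\<close>, in the direction of \<open>s_hat p i\<close>; the
  factor in front makes this the integral with respect to arc length.
\<close>

definition side_integral :: "(3 \<Rightarrow> real^3) \<Rightarrow> 3 \<Rightarrow> (real^3 \<Rightarrow> real) \<Rightarrow> real" where
  "side_integral p i G = side_len p i * (LINT t:{0..1}|lborel. G (p (i + 1) + t *\<^sub>R side_vec p i))"

lemma triangle_param_has_derivative:
  "(triangle_param p has_derivative (\<lambda>h. fst h *\<^sub>R (p 2 - p 1) + snd h *\<^sub>R (p 3 - p 1))) (at x)"
  unfolding triangle_param_def case_prod_beta by (auto intro!: derivative_eq_intros)

lemma continuous_on_triangle_param:
  assumes "continuous_on (triangle p) g"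
  shows "continuous_on ref_triangle (\<lambda>x. g (triangle_param p x))"
proof -
  have "continuous_on ref_triangle (triangle_param p)"
    unfolding triangle_param_def case_prod_beta by (intro continuous_intros)
  then show ?thesis
    by (rule continuous_on_compose2[OF assms]) (simp add: triangle_param_image)
qed

context triangle_frame
begin

lemma triangle_integral_param:
  "triangle_integral p g = (l 3 * v3 p) *\<^sub>R (LINT x:ref_triangle|lborel. g (triangle_param p x))"
proof -
  have "frechet_derivative (triangle_param p) (at x) =
      (\<lambda>h. fst h *\<^sub>R (p 2 - p 1) + snd h *\<^sub>R (p 3 - p 1))" for x
    using frechet_derivative_at[OF triangle_param_has_derivative] by simp
  then show ?thesis
    by (simp add: triangle_integral_def surface_integral_def area_factor)
qed

lemma triangle_integrable:
  fixes g :: "real^3 \<Rightarrow> 'b::{banach, second_countable_topology}"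
  assumes "continuous_on (triangle p) g"
  shows "set_integrable lborel ref_triangle (\<lambda>x. g (triangle_param p x))"
  unfolding set_integrable_def
  by (rule borel_integrable_compact[OF compact_ref_triangle continuous_on_triangle_param[OF assms]])

lemma triangle_integral_cong:
  assumes "\<And>r. r \<in> triangle p \<Longrightarrow> f r = g r"
  shows "triangle_integral p f = triangle_integral p g"
proof -
  have "(LINT x:ref_triangle|lborel. f (triangle_param p x)) =
      (LINT x:ref_triangle|lborel. g (triangle_param p x))"
    unfolding set_lebesgue_integral_def
    using assms triangle_param_image[of p]
    by (intro Bochner_Integration.integral_cong) (auto simp: indicator_def)
  then show ?thesis by (simp add: triangle_integral_param)
qed

lemma triangle_integral_add:
  fixes f g :: "real^3 \<Rightarrow> 'b::{banach, second_countable_topology}"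
  assumes "continuous_on (triangle p) f" "continuous_on (triangle p) g"
  shows "triangle_integral p (\<lambda>r. f r + g r) = triangle_integral p f + triangle_integral p g"
  by (simp add: triangle_integral_param set_integral_add triangle_integrable assms algebra_simps)

lemma triangle_integral_scale:
  fixes c :: real
  shows "triangle_integral p (\<lambda>r. c * f r) = c * triangle_integral p f"
  by (simp add: triangle_integral_param mult.left_commute)

lemma triangle_integral_scaleR_left:
  fixes c :: "'b::{banach, second_countable_topology}"
  assumes "continuous_on (triangle p) f"
  shows "triangle_integral p (\<lambda>r. f r *\<^sub>R c) = triangle_integral p f *\<^sub>R c"
proof -
  have "(LINT x:ref_triangle|lborel. f (triangle_param p x) *\<^sub>R c) =
      (\<integral>x. (indicator ref_triangle x *\<^sub>R f (triangle_param p x)) *\<^sub>R c \<partial>lborel)"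
    by (simp add: set_lebesgue_integral_def)
  also have "\<dots> = (LINT x:ref_triangle|lborel. f (triangle_param p x)) *\<^sub>R c"
    unfolding set_lebesgue_integral_def
    using triangle_integrable[OF assms] unfolding set_integrable_def by (rule integral_scaleR_left)
  finally show ?thesis by (simp add: triangle_integral_param)
qed

text \<open>
  The field here is \<open>G\<close> times the constant direction \<open>d\<close>, whose surface divergence is the derivative of
  \<open>G\<close> along \<open>d\<close>.  Pulled back to the reference triangle, Fubini and the fundamental theorem of calculus
  integrate the derivatives of \<open>G\<close> along the two parameter directions: the first gives the mean of \<open>G\<close>
  over side 1 minus that over side 2, the second the mean over side 1 minus that over side 3.  The
  coefficients of \<open>d\<close> in these directions are given by \<open>tangent_decomposition\<close>, and those of side 1
  combine by \<open>m_hat_sum\<close>.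
\<close>

theorem triangle_divergence:
  fixes G :: "real^3 \<Rightarrow> real" and G' :: "real^3 \<Rightarrow> real^3"
  assumes grad: "\<And>r. r \<in> triangle p \<Longrightarrow> GDERIV G r :> G' r"
    and cont: "continuous_on (triangle p) G'"
    and tangent: "d \<bullet> w = 0"
  shows "triangle_integral p (\<lambda>r. d \<bullet> G' r) = (\<Sum>i\<in>UNIV. (d \<bullet> m_hat p i) * side_integral p i G)"
proof -
  define A B where "A = p 2 - p 1" and "B = p 3 - p 1"
  define \<gamma> where "\<gamma> = triangle_param p"
  define E where "E i = (LINT t:{0..1}|lborel. G (p (i + 1) + t *\<^sub>R side_vec p i))" for i
  have \<gamma>: "\<gamma> (a, b) = p 1 + a *\<^sub>R A + b *\<^sub>R B" for a b
    by (simp add: \<gamma>_def triangle_param_def A_def B_def)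
  have \<gamma>_mem: "\<gamma> x \<in> triangle p" if "x \<in> ref_triangle" for x
    using triangle_param_image[of p] that by (auto simp: \<gamma>_def)
  have cont_dir: "continuous_on ref_triangle (\<lambda>x. e \<bullet> G' (\<gamma> x))" for e
    unfolding \<gamma>_def
    by (intro continuous_intros continuous_on_triangle_param cont)
  have deriv_a: "((\<lambda>s. G (\<gamma> (s, b))) has_real_derivative A \<bullet> G' (\<gamma> (a, b))) (at a)"
    if "(a, b) \<in> ref_triangle" for a b
  proof -
    have "((\<lambda>s. \<gamma> (s, b)) has_derivative (\<lambda>h. h *\<^sub>R A)) (at a)"
      unfolding \<gamma> by (auto intro!: derivative_eq_intros)
    from has_derivative_compose[OF this grad[OF \<gamma>_mem[OF that], unfolded gderiv_def]]
    show ?thesis by (simp add: has_field_derivative_def mult_commute_abs)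
  qed
  have deriv_b: "((\<lambda>s. G (\<gamma> (a, s))) has_real_derivative B \<bullet> G' (\<gamma> (a, b))) (at b)"
    if "(a, b) \<in> ref_triangle" for a b
  proof -
    have "((\<lambda>s. \<gamma> (a, s)) has_derivative (\<lambda>h. h *\<^sub>R B)) (at b)"
      unfolding \<gamma> by (auto intro!: derivative_eq_intros)
    from has_derivative_compose[OF this grad[OF \<gamma>_mem[OF that], unfolded gderiv_def]]
    show ?thesis by (simp add: has_field_derivative_def mult_commute_abs)
  qed
  have G_cont: "continuous_on (triangle p) G"
    using grad unfolding gderiv_def
    by (meson has_derivative_continuous continuous_at_imp_continuous_on)
  have edge_int: "set_integrable lborel {0..1} (\<lambda>t. G (\<gamma> (a + t * a', b + t * b')))"
    if "\<And>t. t \<in> {0..1} \<Longrightarrow> (a + t * a', b + t * b') \<in> ref_triangle" for a a' b b'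
    unfolding set_integrable_def
  proof (rule borel_integrable_compact)
    have "continuous_on {0..1} (\<lambda>t. (a + t * a', b + t * b'))" by (intro continuous_intros)
    from continuous_on_compose2[OF continuous_on_triangle_param[OF G_cont, folded \<gamma>_def] this]
    show "continuous_on {0..1} (\<lambda>t. G (\<gamma> (a + t * a', b + t * b')))"
      using that by (simp add: image_subset_iff)
  qed simp
  have E1: "E 1 = (LINT b:{0..1}|lborel. G (\<gamma> (1 - b, b)))"
    unfolding E_def \<gamma> cyclic_index side_vec_expand A_def B_def
    by (intro set_lebesgue_integral_cong) (auto simp: algebra_simps)
  \<comment> \<open>Side 1 is the only side seen by both parameter directions, once in each orientation.\<close>
  have E1': "E 1 = (LINT a:{0..1}|lborel. G (\<gamma> (a, 1 - a)))"
    unfolding E1 by (subst set_integral_reflect[symmetric]) simp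
  have E3: "E 3 = (LINT a:{0..1}|lborel. G (\<gamma> (a, 0)))"
    unfolding E_def \<gamma> cyclic_index side_vec_expand A_def B_def
    by (intro set_lebesgue_integral_cong) (auto simp: algebra_simps)
  have "E 2 = (LINT b:{0..1}|lborel. G (\<gamma> (0, 1 - b)))"
    unfolding E_def \<gamma> cyclic_index side_vec_expand A_def B_def
    by (intro set_lebesgue_integral_cong) (auto simp: algebra_simps)
  then have E2: "E 2 = (LINT b:{0..1}|lborel. G (\<gamma> (0, b)))"
    using set_integral_reflect[of "\<lambda>b. G (\<gamma> (0, b))"] by simp
  have "(LINT x:ref_triangle|lborel. A \<bullet> G' (\<gamma> x)) =
      (LINT b:{0..1}|lborel. LINT a:{0..1-b}|lborel. A \<bullet> G' (\<gamma> (a, b)))"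
    by (rule ref_triangle_integral_slices(2)[OF cont_dir])
  also have "\<dots> = (LINT b:{0..1}|lborel. G (\<gamma> (1 - b, b)) - G (\<gamma> (0, b)))"
  proof (rule set_lebesgue_integral_cong; clarsimp)
    fix b :: real assume b: "0 \<le> b" "b \<le> 1"
    have mem: "(a, b) \<in> ref_triangle" if "a \<in> {0..1-b}" for a
      using that b by (simp add: ref_triangle_def)
    have "continuous_on {0..1-b} (\<lambda>a. (a, b))" by (intro continuous_intros)
    from continuous_on_compose2[OF cont_dir this, of A]
    have "continuous_on {0..1-b} (\<lambda>a. A \<bullet> G' (\<gamma> (a, b)))"
      using mem by (simp add: image_subset_iff)
    then show "(LINT a:{0..1-b}|lborel. A \<bullet> G' (\<gamma> (a, b))) = G (\<gamma> (1 - b, b)) - G (\<gamma> (0, b))"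
      using b mem by (intro set_integral_FTC deriv_a) auto
  qed
  also have "\<dots> = E 1 - E 2"
    unfolding E1 E2 using edge_int[of 1 "- 1" 0 1] edge_int[of 0 0 0 1]
    by (intro set_integral_diff(2)) (auto simp: ref_triangle_def)
  finally have int_A: "(LINT x:ref_triangle|lborel. A \<bullet> G' (\<gamma> x)) = E 1 - E 2" .
  have "(LINT x:ref_triangle|lborel. B \<bullet> G' (\<gamma> x)) =
      (LINT a:{0..1}|lborel. LINT b:{0..1-a}|lborel. B \<bullet> G' (\<gamma> (a, b)))"
    by (rule ref_triangle_integral_slices(1)[OF cont_dir])
  also have "\<dots> = (LINT a:{0..1}|lborel. G (\<gamma> (a, 1 - a)) - G (\<gamma> (a, 0)))"
  proof (rule set_lebesgue_integral_cong; clarsimp)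
    fix a :: real assume a: "0 \<le> a" "a \<le> 1"
    have mem: "(a, b) \<in> ref_triangle" if "b \<in> {0..1-a}" for b
      using that a by (simp add: ref_triangle_def)
    have "continuous_on {0..1-a} (\<lambda>b. (a, b))" by (intro continuous_intros)
    from continuous_on_compose2[OF cont_dir this, of B]
    have "continuous_on {0..1-a} (\<lambda>b. B \<bullet> G' (\<gamma> (a, b)))"
      using mem by (simp add: image_subset_iff)
    then show "(LINT b:{0..1-a}|lborel. B \<bullet> G' (\<gamma> (a, b))) = G (\<gamma> (a, 1 - a)) - G (\<gamma> (a, 0))"
      using a mem by (intro set_integral_FTC deriv_b) auto
  qed
  also have "\<dots> = E 1 - E 3"
    unfolding E1' E3 using edge_int[of 0 1 1 "- 1"] edge_int[of 0 1 0 0]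
    by (intro set_integral_diff(2)) (auto simp: ref_triangle_def)
  finally have int_B: "(LINT x:ref_triangle|lborel. B \<bullet> G' (\<gamma> x)) = E 1 - E 3" .
  define M where "M i = d \<bullet> (l i *\<^sub>R m_hat p i)" for i
  have M1: "M 1 = - M 2 - M 3"
    unfolding M_def m_hat_sum by (simp add: inner_diff_right inner_minus_right)
  have int: "set_integrable lborel ref_triangle (\<lambda>x. e \<bullet> G' (\<gamma> x))" for e
    unfolding set_integrable_def by (rule borel_integrable_compact[OF compact_ref_triangle cont_dir])
  have "triangle_integral p (\<lambda>r. d \<bullet> G' r) =
      (LINT x:ref_triangle|lborel. (l 3 * v3 p) *\<^sub>R d \<bullet> G' (\<gamma> x))"
    by (simp add: triangle_integral_param \<gamma>_def)
  also have "\<dots> = (LINT x:ref_triangle|lborel. (- M 2) * (A \<bullet> G' (\<gamma> x)) - M 3 * (B \<bullet> G' (\<gamma> x)))"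
    unfolding tangent_decomposition[OF tangent] M_def[symmetric] A_def[symmetric] B_def[symmetric]
    by (simp add: inner_diff_left inner_minus_left)
  also have "\<dots> = (LINT x:ref_triangle|lborel. (- M 2) * (A \<bullet> G' (\<gamma> x)))
      - (LINT x:ref_triangle|lborel. M 3 * (B \<bullet> G' (\<gamma> x)))"
    by (intro set_integral_diff(2) set_integrable_mult_right int)
  also have "\<dots> = (- M 2) * (E 1 - E 2) - M 3 * (E 1 - E 3)"
    by (simp only: set_integral_mult_right int_A int_B)
  also have "\<dots> = M 1 * E 1 + M 2 * E 2 + M 3 * E 3"
    unfolding M1 by (simp add: algebra_simps)
  finally show ?thesis
    by (simp add: sum_3 M_def side_integral_def E_def algebra_simps)
qed

end

section \<open>Gradients of radial functions\<close>

lemma GDERIV_radial: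
  fixes r r0 :: "'a::real_inner"
  assumes "r \<noteq> r0" "(h has_real_derivative h') (at (norm (r - r0)))"
  shows "GDERIV (\<lambda>r. h (norm (r - r0))) r :> (h' / norm (r - r0)) *\<^sub>R (r - r0)"
proof -
  have "((\<lambda>r. r - r0) has_derivative (\<lambda>h. h)) (at r)"
    by (auto intro!: derivative_eq_intros)
  moreover have "(norm has_derivative (\<lambda>h. h \<bullet> sgn (r - r0))) (at (r - r0))"
    using GDERIV_norm[of "r - r0"] assms by (simp add: gderiv_def)
  ultimately have "GDERIV (\<lambda>r. norm (r - r0)) r :> sgn (r - r0)"
    unfolding gderiv_def by (rule has_derivative_compose)
  from GDERIV_DERIV_compose[OF this assms(2)] show ?thesis
    by (simp add: sgn_div_norm divide_inverse)
qed

lemma GDERIV_radial_moment: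
  fixes r r0 e :: "'a::real_inner"
  assumes "r \<noteq> r0" "(h has_real_derivative h') (at (norm (r - r0)))"
  shows "GDERIV (\<lambda>r. ((r - r0) \<bullet> e) * h (norm (r - r0))) r :>
    h (norm (r - r0)) *\<^sub>R e + (((r - r0) \<bullet> e) * h' / norm (r - r0)) *\<^sub>R (r - r0)"
proof -
  have "GDERIV (\<lambda>r. (r - r0) \<bullet> e) r :> e"
    unfolding gderiv_def by (auto intro!: derivative_eq_intros)
  from GDERIV_mult[OF this GDERIV_radial[OF assms]] show ?thesis
    by (simp add: add.commute)
qed

lemma deriv_inverse_power:
  fixes x :: real
  assumes "x \<noteq> 0"
  shows "((\<lambda>x. 1 / x) has_real_derivative - 1 / x\<^sup>2) (at x)"
    "((\<lambda>x. 1 / x ^ 3) has_real_derivative - 3 / x ^ 4) (at x)"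
  using assms by (auto intro!: derivative_eq_intros simp: field_simps power2_eq_square eval_nat_numeral)

lemma grad_dipole_potential:
  assumes "r \<noteq> r0"
  shows "grad (dipole_potential q r0) r =
    (1 / norm (r - r0) ^ 3) *\<^sub>R q - (3 * (q \<bullet> (r - r0)) / norm (r - r0) ^ 5) *\<^sub>R (r - r0)"
proof -
  let ?D = "(1 / norm (r - r0) ^ 3) *\<^sub>R q - (3 * (q \<bullet> (r - r0)) / norm (r - r0) ^ 5) *\<^sub>R (r - r0)"
  have "norm (r - r0) \<noteq> 0" using assms by simp
  from GDERIV_radial_moment[OF assms deriv_inverse_power(2)[OF this], of q]
  have D: "GDERIV (dipole_potential q r0) r :> ?D"
    by (simp add: dipole_potential_def[abs_def] inner_commute eval_nat_numeral ac_simps)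
  have "D' = ?D" if "GDERIV (dipole_potential q r0) r :> D'" for D'
  proof -
    have "(\<lambda>h. h \<bullet> D') = (\<lambda>h. h \<bullet> ?D)"
      using has_derivative_unique that D unfolding gderiv_def by blast
    then show ?thesis by (metis vector_eq_ldot)
  qed
  with D show ?thesis unfolding grad_def by blast
qed

section \<open>Primitives along a straight line\<close>

lemma DERIV_root:
  fixes c s :: real
  assumes "s\<^sup>2 + c > 0"
  shows "((\<lambda>s. sqrt (s\<^sup>2 + c)) has_real_derivative s / sqrt (s\<^sup>2 + c)) (at s)"
  using assms by (auto intro!: derivative_eq_intros simp: field_simps)

text \<open>
  In this and the next primitives, \<open>c\<close> is the squared distance of the source from the line.
\<close>

lemma DERIV_inverse_cube:
  fixes c s :: real
  assumes "c > 0"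
  shows "((\<lambda>s. s / (c * sqrt (s\<^sup>2 + c))) has_real_derivative 1 / sqrt (s\<^sup>2 + c) ^ 3) (at s)"
proof -
  have pos: "s\<^sup>2 + c > 0" using assms by (simp add: add_nonneg_pos)
  define R where "R = sqrt (s\<^sup>2 + c)"
  have R: "R > 0" "R\<^sup>2 = s\<^sup>2 + c" using pos by (simp_all add: R_def)
  have "((\<lambda>s. s / (c * sqrt (s\<^sup>2 + c))) has_real_derivative
      (1 * (c * R) - s * (c * (s / R))) / (c * R * (c * R))) (at s)"
    using DERIV_divide[OF DERIV_ident DERIV_cmult[OF DERIV_root[OF pos], of c]] assms R(1)
    by (simp add: R_def)
  moreover have "(1 * (c * R) - s * (c * (s / R))) / (c * R * (c * R)) = (R\<^sup>2 - s\<^sup>2) / (c * R ^ 3)"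
    using R(1) assms by (simp add: field_simps power2_eq_square power3_eq_cube)
  moreover have "(R\<^sup>2 - s\<^sup>2) / (c * R ^ 3) = 1 / R ^ 3" using R assms by simp
  ultimately show ?thesis by (simp add: R_def)
qed

lemma DERIV_minus_inverse:
  fixes c s :: real
  assumes "s\<^sup>2 + c > 0"
  shows "((\<lambda>s. - 1 / sqrt (s\<^sup>2 + c)) has_real_derivative s / sqrt (s\<^sup>2 + c) ^ 3) (at s)"
proof -
  have "sqrt (s\<^sup>2 + c) > 0" using assms by simp
  then show ?thesis
    by (auto intro!: derivative_eq_intros DERIV_root[OF assms]
        simp: field_simps power2_eq_square power3_eq_cube)
qed

lemma DERIV_ln_root:
  fixes c s :: real
  assumes "c > 0"
  shows "((\<lambda>s. ln (sqrt (s\<^sup>2 + c) + s)) has_real_derivative 1 / sqrt (s\<^sup>2 + c)) (at s)"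
    "sqrt (s\<^sup>2 + c) + s > 0"
proof -
  have pos: "s\<^sup>2 + c > 0" using assms by (simp add: add_nonneg_pos)
  have "\<bar>s\<bar> < sqrt (s\<^sup>2 + c)" using assms by (simp add: real_less_rsqrt)
  then show sum: "sqrt (s\<^sup>2 + c) + s > 0" by linarith
  have R: "sqrt (s\<^sup>2 + c) > 0" using pos by simp
  have "((\<lambda>s. ln (sqrt (s\<^sup>2 + c) + s)) has_real_derivative
      inverse (sqrt (s\<^sup>2 + c) + s) * (s / sqrt (s\<^sup>2 + c) + 1)) (at s)"
    by (rule DERIV_chain2[where g = "\<lambda>s. sqrt (s\<^sup>2 + c) + s", OF DERIV_ln[OF sum]])
      (intro DERIV_add DERIV_root[OF pos] DERIV_ident)
  moreover have "inverse (sqrt (s\<^sup>2 + c) + s) * (s / sqrt (s\<^sup>2 + c) + 1) = 1 / sqrt (s\<^sup>2 + c)"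
    using sum R by (simp add: divide_simps add.commute)
  ultimately show "((\<lambda>s. ln (sqrt (s\<^sup>2 + c) + s)) has_real_derivative 1 / sqrt (s\<^sup>2 + c)) (at s)"
    by simp
qed

lemma DERIV_ln_root_plus:
  fixes c s k :: real
  assumes "c > 0" "k \<ge> 0"
  shows "((\<lambda>s. ln (sqrt (s\<^sup>2 + c) + k)) has_real_derivative
      s / (sqrt (s\<^sup>2 + c) * (sqrt (s\<^sup>2 + c) + k))) (at s)"
proof -
  have pos: "s\<^sup>2 + c > 0" using assms by (simp add: add_nonneg_pos)
  then have sum: "sqrt (s\<^sup>2 + c) + k > 0" using assms by (simp add: add_pos_nonneg)
  have "((\<lambda>s. ln (sqrt (s\<^sup>2 + c) + k)) has_real_derivative
      inverse (sqrt (s\<^sup>2 + c) + k) * (s / sqrt (s\<^sup>2 + c) + 0)) (at s)"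
    by (rule DERIV_chain2[where g = "\<lambda>s. sqrt (s\<^sup>2 + c) + k", OF DERIV_ln[OF sum]])
      (intro DERIV_add DERIV_root[OF pos] DERIV_const)
  then show ?thesis by (simp add: divide_inverse ac_simps)
qed

text \<open>
  With \<open>R\<close> the root, \<open>c = t\<^sup>2 + k\<^sup>2\<close> and \<open>D = c + k * R\<close> the denominator, the computation rests on the
  identities \<open>D\<^sup>2 + t\<^sup>2 * s\<^sup>2 = c * (R + k)\<^sup>2\<close> and \<open>R * D - k * s\<^sup>2 = c * (R + k)\<close>.
\<close>

lemma DERIV_solid_angle:
  fixes t k s :: real
  assumes "k > 0"
  shows "((\<lambda>s. arctan (t * s / (t\<^sup>2 + k\<^sup>2 + k * sqrt (s\<^sup>2 + (t\<^sup>2 + k\<^sup>2))))) has_real_derivative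
      t / (sqrt (s\<^sup>2 + (t\<^sup>2 + k\<^sup>2)) * (sqrt (s\<^sup>2 + (t\<^sup>2 + k\<^sup>2)) + k))) (at s)"
proof -
  define c where "c = t\<^sup>2 + k\<^sup>2"
  define R where "R = sqrt (s\<^sup>2 + c)"
  define D where "D = c + k * R"
  have c: "c > 0" using assms by (simp add: c_def add_nonneg_pos)
  have pos: "s\<^sup>2 + c > 0" using c by (simp add: add_nonneg_pos)
  have R: "R > 0" "R\<^sup>2 = s\<^sup>2 + c" using pos by (simp_all add: R_def)
  have D: "D > 0" using R c assms by (simp add: D_def add_pos_pos)
  have "((\<lambda>s. t * s / (c + k * sqrt (s\<^sup>2 + c))) has_real_derivative
      (t * 1 * D - t * s * (0 + k * (s / R))) / (D * D)) (at s)"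
    unfolding D_def R_def
    by (intro DERIV_divide DERIV_add DERIV_cmult DERIV_ident DERIV_const DERIV_root[OF pos])
      (use D in \<open>simp add: D_def R_def\<close>)
  from DERIV_chain2[OF DERIV_arctan this]
  have deriv: "((\<lambda>s. arctan (t * s / (c + k * sqrt (s\<^sup>2 + c)))) has_real_derivative
      inverse (1 + (t * s / D)\<^sup>2) * ((t * 1 * D - t * s * (0 + k * (s / R))) / (D * D))) (at s)"
    by (simp add: D_def R_def)
  have D2: "D\<^sup>2 + t\<^sup>2 * s\<^sup>2 = c * (R + k)\<^sup>2"
  proof -
    have "D\<^sup>2 + t\<^sup>2 * s\<^sup>2 = c\<^sup>2 + 2 * c * k * R + k\<^sup>2 * R\<^sup>2 + t\<^sup>2 * s\<^sup>2"
      by (simp add: D_def power2_eq_square algebra_simps)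
    also have "\<dots> = c * (R\<^sup>2 + 2 * k * R + k\<^sup>2)"
      unfolding R(2) c_def by (simp add: power2_eq_square algebra_simps)
    finally show ?thesis by (simp add: power2_eq_square algebra_simps)
  qed
  have num: "R * D - k * s\<^sup>2 = c * (R + k)"
  proof -
    have "R * D - k * s\<^sup>2 = R * c + k * (R\<^sup>2 - s\<^sup>2)"
      by (simp add: D_def power2_eq_square algebra_simps)
    then show ?thesis by (simp add: R(2) algebra_simps)
  qed
  have "inverse (1 + (t * s / D)\<^sup>2) * ((t * 1 * D - t * s * (0 + k * (s / R))) / (D * D)) =
      t * (R * D - k * s\<^sup>2) / (R * (D\<^sup>2 + t\<^sup>2 * s\<^sup>2))"
  proof -
    have "1 + (t * s / D)\<^sup>2 = (D\<^sup>2 + t\<^sup>2 * s\<^sup>2) / (D * D)"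
      using D by (simp add: field_simps power2_eq_square)
    moreover have "t * 1 * D - t * s * (0 + k * (s / R)) = t * (R * D - k * s\<^sup>2) / R"
      using R(1) by (simp add: field_simps power2_eq_square)
    ultimately show ?thesis using D by simp
  qed
  also have "\<dots> = t / (R * (R + k))"
    unfolding num D2 using c R(1) assms by (simp add: power2_eq_square)
  finally show ?thesis using deriv by (simp add: c_def R_def)
qed

section \<open>Integrals along the sides\<close>

locale triangle_source = triangle_frame +
  fixes r0 :: "real^3" and u0 v0 w0 :: real
  assumes source: "r0 \<notin> triangle p"
    and source_coords: "r0 = p 1 + u0 *\<^sub>R u_hat p + v0 *\<^sub>R v_hat p - w0 *\<^sub>R w_hat p"
begin

abbreviation "t \<equiv> t0 p u0 v0"
abbreviation "sm \<equiv> s_minus p u0 v0"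
abbreviation "sp \<equiv> s_plus p u0 v0"

lemma start_point_coords:
  "p 2 - r0 = (l 3 - u0) *\<^sub>R u - v0 *\<^sub>R v + w0 *\<^sub>R w"
  "p 3 - r0 = (u3 p - u0) *\<^sub>R u + (v3 p - v0) *\<^sub>R v + w0 *\<^sub>R w"
  "p 1 - r0 = - u0 *\<^sub>R u - v0 *\<^sub>R v + w0 *\<^sub>R w"
proof -
  show 1: "p 1 - r0 = - u0 *\<^sub>R u - v0 *\<^sub>R v + w0 *\<^sub>R w"
    by (simp add: source_coords)
  have "p 2 - r0 = side_vec p 3 + (p 1 - r0)" by (simp add: side_vec_expand)
  then show "p 2 - r0 = (l 3 - u0) *\<^sub>R u - v0 *\<^sub>R v + w0 *\<^sub>R w"
    unfolding 1 side_vec_uv by (simp add: algebra_simps)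
  have "p 3 - r0 = (p 1 - r0) - side_vec p 2" by (simp add: side_vec_expand)
  then show "p 3 - r0 = (u3 p - u0) *\<^sub>R u + (v3 p - v0) *\<^sub>R v + w0 *\<^sub>R w"
    unfolding 1 side_vec_uv by (simp add: algebra_simps)
qed

lemma frame_products:
  "u \<bullet> u = 1" "v \<bullet> v = 1" "w \<bullet> w = 1" "u \<bullet> v = 0" "v \<bullet> u = 0" "u \<bullet> w = 0" "w \<bullet> u = 0"
  "v \<bullet> w = 0" "w \<bullet> v = 0"
  using uw_frame v_facts by (simp_all add: inner_commute)

lemma side_len_sq: "(l 1)\<^sup>2 = (u3 p - l 3)\<^sup>2 + (v3 p)\<^sup>2" "(l 2)\<^sup>2 = (u3 p)\<^sup>2 + (v3 p)\<^sup>2"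
proof -
  have "(l i)\<^sup>2 = side_vec p i \<bullet> side_vec p i" for i by (simp add: side_len_def dot_square_norm)
  then show "(l 1)\<^sup>2 = (u3 p - l 3)\<^sup>2 + (v3 p)\<^sup>2" "(l 2)\<^sup>2 = (u3 p)\<^sup>2 + (v3 p)\<^sup>2"
    by (simp_all add: side_vec_uv inner_add_left inner_add_right inner_diff_left inner_diff_right
        frame_products power2_eq_square)
qed

text \<open>
  The explicit expressions for \<open>s_minus\<close>, \<open>s_plus\<close> and \<open>t0\<close> are the components of the vectors from the
  source to the endpoints of the side in the frame of that side.
\<close>

lemma start_point_products:
  "(p (i + 1) - r0) \<bullet> (l i *\<^sub>R s_hat p i) = l i * sm i"
  "(p (i + 1) - r0) \<bullet> (l i *\<^sub>R m_hat p i) = l i * t i"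
  "(p (i + 1) - r0) \<bullet> w = w0"
  "sp i = sm i + l i"
proof -
  have pos: "l 1 \<noteq> 0" "l 2 \<noteq> 0" "l 3 \<noteq> 0" using side_len_pos by (simp_all add: less_imp_neq[symmetric])
  have "i = 1 \<or> i = 2 \<or> i = 3" by (rule exhaust_3)
  then have "(p (i + 1) - r0) \<bullet> (l i *\<^sub>R s_hat p i) = l i * sm i \<and>
    (p (i + 1) - r0) \<bullet> (l i *\<^sub>R m_hat p i) = l i * t i \<and>
    (p (i + 1) - r0) \<bullet> w = w0 \<and> l i * sp i = l i * sm i + (l i)\<^sup>2"
  proof (elim disjE)
    assume i: "i = 1"
    have "l 1 * sm 1 = - ((l 3 - u0) * (l 3 - u3 p) + v0 * v3 p)"
      "l 1 * sp 1 = (u3 p - u0) * (u3 p - l 3) + v3 p * (v3 p - v0)"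
      "l 1 * t 1 = v0 * (u3 p - l 3) + v3 p * (l 3 - u0)"
      using pos by (simp_all add: s_minus_def s_plus_def t0_def Let_def)
    then show ?thesis
      unfolding i cyclic_index start_point_coords side_vec_hat[symmetric] m_hat_uv
        side_vec_uv side_len_sq
      by (simp add: inner_add_left inner_add_right inner_diff_left inner_diff_right
          frame_products algebra_simps power2_eq_square)
  next
    assume i: "i = 2"
    have "l 2 * sm 2 = - (u3 p * (u3 p - u0) + v3 p * (v3 p - v0))"
      "l 2 * sp 2 = u0 * u3 p + v0 * v3 p"
      "l 2 * t 2 = u0 * v3 p - v0 * u3 p"
      using pos by (simp_all add: s_minus_def s_plus_def t0_def Let_def)
    then show ?thesis
      unfolding i cyclic_index start_point_coords side_vec_hat[symmetric] m_hat_uv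
        side_vec_uv side_len_sq
      by (simp add: inner_add_left inner_add_right inner_diff_left inner_diff_right
          frame_products algebra_simps power2_eq_square)
  next
    assume i: "i = 3"
    have ends: "sm 3 = - u0" "sp 3 = l 3 - u0" "t 3 = v0"
      by (simp_all add: s_minus_def s_plus_def t0_def Let_def)
    show ?thesis
      unfolding i cyclic_index start_point_coords side_vec_hat[symmetric] m_hat_uv
        side_vec_uv ends
      by (simp add: inner_add_left inner_add_right inner_diff_left inner_diff_right
          frame_products algebra_simps power2_eq_square)
  qed
  moreover have "l i * sm i + (l i)\<^sup>2 = l i * (sm i + l i)"
    by (simp add: power2_eq_square distrib_left)
  ultimately show "(p (i + 1) - r0) \<bullet> (l i *\<^sub>R s_hat p i) = l i * sm i"
    "(p (i + 1) - r0) \<bullet> (l i *\<^sub>R m_hat p i) = l i * t i"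
    "(p (i + 1) - r0) \<bullet> w = w0" "sp i = sm i + l i"
    using side_len_pos[of i] by auto
qed

lemma side_point:
  "p (i + 1) + a *\<^sub>R side_vec p i - r0 = (sm i + a * l i) *\<^sub>R s_hat p i + t i *\<^sub>R m_hat p i + w0 *\<^sub>R w"
proof -
  have "(p (i + 1) - r0) \<bullet> s_hat p i = sm i" "(p (i + 1) - r0) \<bullet> m_hat p i = t i"
    using start_point_products(1,2)[of i] side_len_pos[of i] by simp_all
  then have "p (i + 1) - r0 = sm i *\<^sub>R s_hat p i + t i *\<^sub>R m_hat p i + w0 *\<^sub>R w"
    using smw_expansion[of "p (i + 1) - r0" i] start_point_products(3)[of i] by simp
  then show ?thesis
    unfolding side_vec_hat by (simp add: algebra_simps)
qed

lemma side_mem_triangle: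
  assumes "a \<in> {0..1}"
  shows "p (i + 1) + a *\<^sub>R side_vec p i \<in> triangle p"
proof -
  have eq: "p (i + 1) + a *\<^sub>R side_vec p i = (1 - a) *\<^sub>R p (i + 1) + a *\<^sub>R p (i - 1)"
    by (simp add: side_vec_def algebra_simps)
  have "p j \<in> triangle p" for j
    using exhaust_3[of j] by (auto simp: triangle_def intro: hull_inc)
  then show ?thesis
    unfolding eq using assms convex_convex_hull unfolding triangle_def
    by (intro convexD) auto
qed

lemma side_moment:
  assumes "e \<bullet> w = 0"
  shows "(p (i + 1) + a *\<^sub>R side_vec p i - r0) \<bullet> e =
    (s_hat p i \<bullet> e) * (sm i + a * l i) + (m_hat p i \<bullet> e) * t i"
  unfolding side_point using assms
  by (simp add: inner_add_left inner_commute[of w] mult.commute)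

lemma side_distance:
  "norm (p (i + 1) + a *\<^sub>R side_vec p i - r0) = sqrt ((sm i + a * l i)\<^sup>2 + ((t i)\<^sup>2 + w0\<^sup>2))"
proof -
  have "(norm (p (i + 1) + a *\<^sub>R side_vec p i - r0))\<^sup>2 = (sm i + a * l i)\<^sup>2 + ((t i)\<^sup>2 + w0\<^sup>2)"
    unfolding side_point dot_square_norm[symmetric]
    using s_hat_frame(1,3)[of i] m_hat_facts[of i] w_unit
    by (simp add: inner_add_left inner_add_right inner_commute power2_eq_square)
  then show ?thesis by (metis norm_ge_zero real_sqrt_unique)
qed

text \<open>
  A zero would place the source on the side.  If the source lies on the line through the side, this is what
  keeps \<open>s\<close> away from 0.
\<close>

lemma side_distance_pos:
  assumes "s \<in> {sm i..sp i}"
  shows "s\<^sup>2 + ((t i)\<^sup>2 + w0\<^sup>2) > 0"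
proof -
  define a where "a = (s - sm i) / l i"
  have a: "a \<in> {0..1}" and s: "s = sm i + a * l i"
    using assms side_len_pos[of i] start_point_products(4)[of i] by (auto simp: a_def)
  have "p (i + 1) + a *\<^sub>R side_vec p i \<noteq> r0" using side_mem_triangle[OF a] source by metis
  then have "norm (p (i + 1) + a *\<^sub>R side_vec p i - r0) > 0" by simp
  then show ?thesis unfolding side_distance s by simp
qed

lemma side_distance_ends:
  "R_plus p u0 v0 w0 i = sqrt ((sp i)\<^sup>2 + ((t i)\<^sup>2 + w0\<^sup>2))"
  "R_minus p u0 v0 w0 i = sqrt ((sm i)\<^sup>2 + ((t i)\<^sup>2 + w0\<^sup>2))"
  by (simp_all add: R_plus_def R_minus_def add.assoc)

lemma side_integral_FTC:
  assumes deriv: "\<And>s. s \<in> {sm i..sp i} \<Longrightarrow> (H has_real_derivative h s) (at s)"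
    and cont: "continuous_on {sm i..sp i} h"
    and eq: "\<And>a. G (p (i + 1) + a *\<^sub>R side_vec p i) = h (sm i + a * l i)"
  shows "side_integral p i G = H (sp i) - H (sm i)"
proof -
  have mem: "sm i + a * l i \<in> {sm i..sp i}" if "a \<in> {0..1}" for a
    unfolding start_point_products(4)
    using that side_len_pos[of i] mult_right_mono[of a 1 "l i"] by (simp add: less_imp_le)
  have "continuous_on {0..1} (\<lambda>a. sm i + a * l i)" by (intro continuous_intros)
  then have "continuous_on {0..1} (\<lambda>a. h (sm i + a * l i))"
    by (rule continuous_on_compose2[OF cont]) (use mem in auto)
  then have "(LINT a:{0..1}|lborel. h (sm i + a * l i) * l i) = H (sm i + 1 * l i) - H (sm i + 0 * l i)"
    by (intro set_integral_FTC DERIV_chain2[OF deriv] mem)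
      (auto intro!: derivative_eq_intros continuous_intros)
  then show ?thesis
    unfolding side_integral_def eq start_point_products(4) by (simp add: mult.commute)
qed

lemma root_nonzero: "s \<in> {sm i..sp i} \<Longrightarrow> sqrt (s\<^sup>2 + ((t i)\<^sup>2 + w0\<^sup>2)) \<noteq> 0"
  using side_distance_pos by fastforce

lemma Rs_eq:
  "Rs p u0 v0 w0 i = sp i / (((t i)\<^sup>2 + w0\<^sup>2) * R_plus p u0 v0 w0 i)
    - sm i / (((t i)\<^sup>2 + w0\<^sup>2) * R_minus p u0 v0 w0 i)"
  by (simp add: Rs_def R0_def diff_divide_distrib mult.commute)

lemma side_integral_inverse_cube:
  assumes "(t i)\<^sup>2 + w0\<^sup>2 \<noteq> 0"
  shows "side_integral p i (\<lambda>r. 1 / norm (r - r0) ^ 3) = Rs p u0 v0 w0 i"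
proof -
  have c: "(t i)\<^sup>2 + w0\<^sup>2 > 0" using assms sum_power2_ge_zero[of "t i" w0] by linarith
  show ?thesis
    unfolding Rs_eq side_distance_ends
    by (rule side_integral_FTC[OF DERIV_inverse_cube[OF c]])
      (auto simp: side_distance intro!: continuous_intros root_nonzero dest: root_nonzero)
qed

text \<open>
  If the source is on the line through the side, then \<open>t i = 0\<close>, so the part of the primitive that has
  the then vanishing \<open>c\<close> in its denominator is multiplied by 0, and the formula holds there too.
\<close>

lemma side_integral_moment:
  assumes "e \<bullet> w = 0"
  shows "side_integral p i (\<lambda>r. (r - r0) \<bullet> e * (1 / norm (r - r0) ^ 3)) =
    (s_hat p i \<bullet> e) * Rd p u0 v0 w0 i + (m_hat p i \<bullet> e) * (t i * Rs p u0 v0 w0 i)"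
proof -
  define c where "c = (t i)\<^sup>2 + w0\<^sup>2"
  define H where "H s = (s_hat p i \<bullet> e) * (- 1 / sqrt (s\<^sup>2 + c))
    + (m_hat p i \<bullet> e) * (t i * (s / (c * sqrt (s\<^sup>2 + c))))" for s
  have H: "(H has_real_derivative (s_hat p i \<bullet> e) * (s / sqrt (s\<^sup>2 + c) ^ 3)
      + (m_hat p i \<bullet> e) * (t i * (1 / sqrt (s\<^sup>2 + c) ^ 3))) (at s)"
    if s: "s \<in> {sm i..sp i}" for s
  proof (cases "t i = 0")
    case True
    have "((\<lambda>s. (s_hat p i \<bullet> e) * (- 1 / sqrt (s\<^sup>2 + c))) has_real_derivative
        (s_hat p i \<bullet> e) * (s / sqrt (s\<^sup>2 + c) ^ 3)) (at s)"
      using side_distance_pos[OF s] unfolding c_def by (intro DERIV_cmult DERIV_minus_inverse)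
    then show ?thesis by (simp add: H_def[abs_def] True)
  next
    case False
    then have "c > 0" by (simp add: c_def sum_power2_gt_zero_iff)
    then show ?thesis
      unfolding H_def[abs_def] using side_distance_pos[OF s, folded c_def]
      by (intro DERIV_add DERIV_cmult DERIV_minus_inverse DERIV_inverse_cube)
  qed
  have "side_integral p i (\<lambda>r. (r - r0) \<bullet> e * (1 / norm (r - r0) ^ 3)) = H (sp i) - H (sm i)"
  proof (rule side_integral_FTC[OF H])
    show "continuous_on {sm i..sp i} (\<lambda>s. (s_hat p i \<bullet> e) * (s / sqrt (s\<^sup>2 + c) ^ 3)
      + (m_hat p i \<bullet> e) * (t i * (1 / sqrt (s\<^sup>2 + c) ^ 3)))"
      using root_nonzero[of _ i, folded c_def] by (intro continuous_intros) auto
    show "(p (i + 1) + a *\<^sub>R side_vec p i - r0) \<bullet> e * (1 / norm (p (i + 1) + a *\<^sub>R side_vec p i - r0) ^ 3) =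
        (s_hat p i \<bullet> e) * ((sm i + a * l i) / sqrt ((sm i + a * l i)\<^sup>2 + c) ^ 3)
      + (m_hat p i \<bullet> e) * (t i * (1 / sqrt ((sm i + a * l i)\<^sup>2 + c) ^ 3))" for a
      unfolding side_distance c_def[symmetric] side_moment[OF assms]
      by (simp only: distrib_right) simp
  qed
  also have "\<dots> = (s_hat p i \<bullet> e) * Rd p u0 v0 w0 i + (m_hat p i \<bullet> e) * (t i * Rs p u0 v0 w0 i)"
    unfolding H_def Rd_def Rs_eq side_distance_ends c_def by (simp add: algebra_simps)
  finally show ?thesis .
qed

text \<open>
  When the source is on the line through the side, the integrand is \<open>1 / \<bar>s\<bar>\<close> and \<open>s\<close> has constant sign on
  the side: positive \<open>s\<close> is covered by the generic quotient in \<open>f2\<close>, negative \<open>s\<close> by the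
  separate value \<open>ln (s_minus / s_plus)\<close>.
\<close>

lemma side_integral_inverse:
  "side_integral p i (\<lambda>r. 1 / norm (r - r0)) = f2 p u0 v0 w0 i"
proof -
  define c where "c = (t i)\<^sup>2 + w0\<^sup>2"
  have lt: "sm i < sp i" using start_point_products(4)[of i] side_len_pos[of i] by simp
  have FTC: "side_integral p i (\<lambda>r. 1 / norm (r - r0)) = H (sp i) - H (sm i)"
    if "\<And>s. s \<in> {sm i..sp i} \<Longrightarrow> (H has_real_derivative 1 / sqrt (s\<^sup>2 + c)) (at s)" for H
    by (rule side_integral_FTC[OF that])
      (auto simp: side_distance c_def intro!: continuous_intros root_nonzero dest: root_nonzero)
  have ends: "R_plus p u0 v0 w0 i = sqrt ((sp i)\<^sup>2 + c)" "R_minus p u0 v0 w0 i = sqrt ((sm i)\<^sup>2 + c)"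
    by (simp_all add: side_distance_ends c_def)
  show ?thesis
  proof (cases "c > 0")
    case True
    then show ?thesis
      using FTC[OF DERIV_ln_root(1)[OF True]] DERIV_ln_root(2)[OF True, of "sm i"]
        DERIV_ln_root(2)[OF True, of "sp i"]
      by (simp add: f2_def Let_def ends ln_div)
  next
    case False
    then have c: "c = 0" using sum_power2_ge_zero[of "t i" w0] by (simp add: c_def)
    have nz: "s \<noteq> 0" if "s \<in> {sm i..sp i}" for s
      using side_distance_pos[OF that] c by (auto simp: c_def)
    have "0 < sm i \<or> sp i < 0"
      using nz[of 0] by force
    then show ?thesis
    proof
      assume pos: "0 < sm i"
      have "side_integral p i (\<lambda>r. 1 / norm (r - r0)) = ln (sp i) - ln (sm i)"
        by (rule FTC) (use pos c in \<open>auto intro!: derivative_eq_intros simp: divide_inverse\<close>)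
      moreover have "f2 p u0 v0 w0 i = ln (sp i / sm i)"
        using pos lt by (simp add: f2_def Let_def ends c)
      ultimately show ?thesis using pos lt by (simp add: ln_div)
    next
      assume neg: "sp i < 0"
      have "side_integral p i (\<lambda>r. 1 / norm (r - r0)) = - ln (- sp i) - (- ln (- sm i))"
        by (rule FTC) (use neg c in \<open>auto intro!: derivative_eq_intros simp: divide_inverse\<close>)
      moreover have "ln (sm i / sp i) = ln (- sm i) - ln (- sp i)"
        using neg lt ln_div[of "- sm i" "- sp i"] by simp
      ultimately show ?thesis using neg lt by (simp add: f2_def Let_def ends c)
    qed
  qed
qed

text \<open>
  The logarithmic part along \<open>s_hat p i\<close> does not survive the summation over an orthonormal basis \<open>e\<close> of the
  plane, as \<open>s_hat p i\<close> is orthogonal to the normal \<open>m_hat p i\<close>.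
\<close>

lemma side_integral_solid_angle:
  assumes "e \<bullet> w = 0" "w0 \<noteq> 0"
  shows "side_integral p i (\<lambda>r. (r - r0) \<bullet> e * (1 / (norm (r - r0) * (norm (r - r0) + \<bar>w0\<bar>)))) =
    (s_hat p i \<bullet> e) * (ln (R_plus p u0 v0 w0 i + \<bar>w0\<bar>) - ln (R_minus p u0 v0 w0 i + \<bar>w0\<bar>))
    + (m_hat p i \<bullet> e) * beta_side p u0 v0 w0 i"
proof -
  define c where "c = (t i)\<^sup>2 + w0\<^sup>2"
  have c: "c > 0" "c = (t i)\<^sup>2 + \<bar>w0\<bar>\<^sup>2" using assms by (simp_all add: c_def sum_power2_gt_zero_iff)
  define H where "H s = (s_hat p i \<bullet> e) * ln (sqrt (s\<^sup>2 + c) + \<bar>w0\<bar>)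
    + (m_hat p i \<bullet> e) * arctan (t i * s / (c + \<bar>w0\<bar> * sqrt (s\<^sup>2 + c)))" for s
  have sum_nz: "sqrt (s\<^sup>2 + c) + \<bar>w0\<bar> \<noteq> 0" for s
    using assms by (smt (verit) real_sqrt_ge_zero c(1) zero_le_power2)
  have H: "(H has_real_derivative (s_hat p i \<bullet> e) * (s / (sqrt (s\<^sup>2 + c) * (sqrt (s\<^sup>2 + c) + \<bar>w0\<bar>)))
      + (m_hat p i \<bullet> e) * (t i / (sqrt (s\<^sup>2 + c) * (sqrt (s\<^sup>2 + c) + \<bar>w0\<bar>)))) (at s)" for s
    unfolding H_def[abs_def]
    using DERIV_solid_angle[of "\<bar>w0\<bar>" "t i" s, folded c(2)] assms
    by (intro DERIV_add DERIV_cmult DERIV_ln_root_plus[OF c(1)]) auto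
  have "side_integral p i (\<lambda>r. (r - r0) \<bullet> e * (1 / (norm (r - r0) * (norm (r - r0) + \<bar>w0\<bar>)))) =
      H (sp i) - H (sm i)"
  proof (rule side_integral_FTC[OF H])
    show "continuous_on {sm i..sp i} (\<lambda>s. (s_hat p i \<bullet> e) * (s / (sqrt (s\<^sup>2 + c) * (sqrt (s\<^sup>2 + c) + \<bar>w0\<bar>)))
      + (m_hat p i \<bullet> e) * (t i / (sqrt (s\<^sup>2 + c) * (sqrt (s\<^sup>2 + c) + \<bar>w0\<bar>))))"
      using root_nonzero[of _ i, folded c_def] sum_nz by (intro continuous_intros) auto
    show "(p (i + 1) + a *\<^sub>R side_vec p i - r0) \<bullet> e *
        (1 / (norm (p (i + 1) + a *\<^sub>R side_vec p i - r0) * (norm (p (i + 1) + a *\<^sub>R side_vec p i - r0) + \<bar>w0\<bar>))) =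
      (s_hat p i \<bullet> e) * ((sm i + a * l i) / (sqrt ((sm i + a * l i)\<^sup>2 + c) * (sqrt ((sm i + a * l i)\<^sup>2 + c) + \<bar>w0\<bar>)))
      + (m_hat p i \<bullet> e) * (t i / (sqrt ((sm i + a * l i)\<^sup>2 + c) * (sqrt ((sm i + a * l i)\<^sup>2 + c) + \<bar>w0\<bar>)))" for a
      unfolding side_distance c_def[symmetric] side_moment[OF assms(1)]
      by (simp only: distrib_right) simp
  qed
  also have "\<dots> = (s_hat p i \<bullet> e) * (ln (R_plus p u0 v0 w0 i + \<bar>w0\<bar>) - ln (R_minus p u0 v0 w0 i + \<bar>w0\<bar>))
    + (m_hat p i \<bullet> e) * beta_side p u0 v0 w0 i"
    using c(1) by (simp add: H_def beta_side_def R0_def side_distance_ends c_def algebra_simps)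
  finally show ?thesis .
qed

end

section \<open>Closed forms of the integrals over the triangle\<close>

context triangle_source
begin

lemma triangle_nonzero: "r \<in> triangle p \<Longrightarrow> r \<noteq> r0"
  using source by auto

lemma triangle_height:
  assumes "r \<in> triangle p"
  shows "(r - r0) \<bullet> w = w0"
proof -
  obtain a b where "r = triangle_param p (a, b)"
    using assms unfolding triangle_param_image[symmetric] by auto
  then have r: "r - r0 = (p (2 + 1) - r0) + (1 - b) *\<^sub>R side_vec p 2 + a *\<^sub>R side_vec p 3"
    unfolding triangle_param_def side_vec_expand cyclic_index by (simp add: algebra_simps)
  show ?thesis
    unfolding r using start_point_products(3)[of 2]
    by (simp add: inner_add_left inner_diff_left side_vec_w)
qed

definition "grad_inverse_cube r = (- 3 / norm (r - r0) ^ 5) *\<^sub>R (r - r0)"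

definition "grad_inverse r = (- 1 / norm (r - r0) ^ 3) *\<^sub>R (r - r0)"

definition "grad_moment e r = (1 / norm (r - r0) ^ 3) *\<^sub>R e
  + (- 3 / norm (r - r0) ^ 5 * ((r - r0) \<bullet> e)) *\<^sub>R (r - r0)"

lemma field_gradients:
  assumes "r \<in> triangle p"
  shows "GDERIV (\<lambda>r. 1 / norm (r - r0) ^ 3) r :> grad_inverse_cube r"
    "GDERIV (\<lambda>r. 1 / norm (r - r0)) r :> grad_inverse r"
    "GDERIV (\<lambda>r. (r - r0) \<bullet> e * (1 / norm (r - r0) ^ 3)) r :> grad_moment e r"
proof -
  have r: "r \<noteq> r0" "norm (r - r0) \<noteq> 0" using triangle_nonzero[OF assms] by simp_all
  have div: "a / x ^ 4 / x = a / x ^ 5" "a / x\<^sup>2 / x = a / x ^ 3" "b * a / x = a / x * b" for a b x :: real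
    by (simp_all add: eval_nat_numeral)
  show "GDERIV (\<lambda>r. 1 / norm (r - r0) ^ 3) r :> grad_inverse_cube r"
    using GDERIV_radial[OF r(1) deriv_inverse_power(2)[OF r(2)]] unfolding grad_inverse_cube_def div .
  show "GDERIV (\<lambda>r. 1 / norm (r - r0)) r :> grad_inverse r"
    using GDERIV_radial[OF r(1) deriv_inverse_power(1)[OF r(2)]] unfolding grad_inverse_def div .
  show "GDERIV (\<lambda>r. (r - r0) \<bullet> e * (1 / norm (r - r0) ^ 3)) r :> grad_moment e r"
    using GDERIV_radial_moment[OF r(1) deriv_inverse_power(2)[OF r(2)], of e]
    unfolding grad_moment_def div(3)[of "(r - r0) \<bullet> e" "- 3 / norm (r - r0) ^ 4" "norm (r - r0)"] div(1) .
qed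

lemma field_continuous:
  "continuous_on (triangle p) grad_inverse_cube" "continuous_on (triangle p) grad_inverse"
  "continuous_on (triangle p) (grad_moment e)"
  "continuous_on (triangle p) (\<lambda>r. 1 / norm (r - r0) ^ 3)"
  unfolding grad_inverse_cube_def[abs_def] grad_inverse_def[abs_def] grad_moment_def[abs_def]
  by (auto intro!: continuous_intros dest: triangle_nonzero)

lemma field_flux:
  assumes "d \<bullet> w = 0"
  shows "triangle_integral p (\<lambda>r. d \<bullet> grad_inverse_cube r) =
      (\<Sum>i\<in>UNIV. (d \<bullet> m_hat p i) * side_integral p i (\<lambda>r. 1 / norm (r - r0) ^ 3))"
    "triangle_integral p (\<lambda>r. d \<bullet> grad_inverse r) =
      (\<Sum>i\<in>UNIV. (d \<bullet> m_hat p i) * side_integral p i (\<lambda>r. 1 / norm (r - r0)))"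
    "triangle_integral p (\<lambda>r. d \<bullet> grad_moment e r) =
      (\<Sum>i\<in>UNIV. (d \<bullet> m_hat p i) * side_integral p i (\<lambda>r. (r - r0) \<bullet> e * (1 / norm (r - r0) ^ 3)))"
  by (intro triangle_divergence field_gradients field_continuous assms; assumption)+

lemma sum_frame:
  assumes "x \<bullet> w = 0"
  shows "(x \<bullet> u) * (y \<bullet> u) + (x \<bullet> v) * (y \<bullet> v) = x \<bullet> y"
  using uvw_inner[of x y] assms by simp

lemma planar_norm:
  assumes "r \<in> triangle p"
  shows "((r - r0) \<bullet> u)\<^sup>2 + ((r - r0) \<bullet> v)\<^sup>2 = (norm (r - r0))\<^sup>2 - w0\<^sup>2"
  using uvw_inner[of "r - r0" "r - r0"] triangle_height[OF assms]
  unfolding power2_norm_eq_inner by (simp add: power2_eq_square)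

text \<open>
  In polar coordinates of the plane around the projection of the source, a radial field \<open>Rt * g\<close> has
  divergence \<open>1 / norm R ^ 3\<close> if \<open>g\<close> times the squared planar distance equals a constant minus
  \<open>1 / norm R\<close>.  The constant \<open>1 / \<bar>w0\<bar>\<close> makes the field regular at the centre and gives
  \<open>g = 1 / (\<bar>w0\<bar> * norm R * (norm R + \<bar>w0\<bar>))\<close>.
\<close>

lemma triangle_integral_inverse_cube:
  "w0 * triangle_integral p (\<lambda>r. 1 / norm (r - r0) ^ 3) = sgn w0 * beta p u0 v0 w0"
proof (cases "w0 = 0")
  case True
  then show ?thesis by simp
next
  case False
  define k where "k = \<bar>w0\<bar>"
  have k: "k > 0" "k\<^sup>2 = w0\<^sup>2" using False by (simp_all add: k_def)
  define h where "h x = 1 / (x * (x + k))" for x :: real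
  define h' where "h' x = - (2 * x + k) / (x * (x + k))\<^sup>2" for x :: real
  define G where "G e r = (r - r0) \<bullet> e * h (norm (r - r0))" for e r
  define G' where "G' e r = h (norm (r - r0)) *\<^sub>R e
    + (((r - r0) \<bullet> e) * h' (norm (r - r0)) / norm (r - r0)) *\<^sub>R (r - r0)" for e r
  have h: "(h has_real_derivative h' x) (at x)" if "x > 0" for x
  proof -
    have "x * (x + k) \<noteq> 0" using that k by simp
    then have "(h has_real_derivative
        (0 * (x * (x + k)) - 1 * (1 * (x + k) + (1 + 0) * x)) / ((x * (x + k)) * (x * (x + k)))) (at x)"
      unfolding h_def[abs_def]
      by (intro DERIV_divide DERIV_mult DERIV_add DERIV_ident DERIV_const)
    then show ?thesis by (simp add: h'_def power2_eq_square)
  qed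
  have norm_pos: "norm (r - r0) > 0" if "r \<in> triangle p" for r
    using triangle_nonzero[OF that] by simp
  have grad: "GDERIV (G e) r :> G' e r" if "r \<in> triangle p" for e r
    unfolding G_def[abs_def] G'_def
    by (rule GDERIV_radial_moment[OF triangle_nonzero[OF that] h[OF norm_pos[OF that]]])
  have nz: "norm (r - r0) + k \<noteq> 0" for r
    using k norm_ge_zero[of "r - r0"] by linarith
  have cont: "continuous_on (triangle p) (G' e)" for e
    unfolding G'_def[abs_def] h_def[abs_def] h'_def[abs_def] using nz
    by (auto intro!: continuous_intros dest: triangle_nonzero)
  have div: "k * (1 / norm (r - r0) ^ 3) = u \<bullet> G' u r + v \<bullet> G' v r" if r: "r \<in> triangle p" for r
  proof -
    define x where "x = norm (r - r0)"
    have x: "x > 0" using norm_pos[OF r] by (simp add: x_def)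
    have "u \<bullet> G' u r + v \<bullet> G' v r = 2 * h x + (((r - r0) \<bullet> u)\<^sup>2 + ((r - r0) \<bullet> v)\<^sup>2) * h' x / x"
      by (simp add: G'_def x_def[symmetric] inner_add_right frame_products
          inner_commute[of u "r - r0"] inner_commute[of v "r - r0"]
          power2_eq_square add_divide_distrib distrib_right distrib_left mult_ac)
    also have "\<dots> = 2 * h x + (x\<^sup>2 - k\<^sup>2) * h' x / x"
      unfolding planar_norm[OF r] x_def[symmetric] k(2) ..
    also have "\<dots> = k * (1 / x ^ 3)"
    proof -
      have "(x\<^sup>2 - k\<^sup>2) * h' x = - ((x - k) * (2 * x + k)) / (x\<^sup>2 * (x + k))"
      proof -
        have "(x\<^sup>2 - k\<^sup>2) * h' x = - (((x - k) * (2 * x + k)) * (x + k)) / ((x\<^sup>2 * (x + k)) * (x + k))"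
          by (simp add: h'_def power2_eq_square algebra_simps)
        then show ?thesis using x k by simp
      qed
      moreover have "2 * h x = 2 * x / (x\<^sup>2 * (x + k))" using x by (simp add: h_def power2_eq_square)
      then have "2 * h x = 2 * x * x / (x\<^sup>2 * (x + k)) / x" using x by simp
      ultimately have "2 * h x + (x\<^sup>2 - k\<^sup>2) * h' x / x =
          (2 * x * x - (x - k) * (2 * x + k)) / (x\<^sup>2 * (x + k)) / x"
        by (simp only: add_divide_distrib[symmetric] diff_conv_add_uminus)
      also have "2 * x * x - (x - k) * (2 * x + k) = k * (x + k)" by (simp add: algebra_simps)
      finally show ?thesis using x k by (simp add: power3_eq_cube power2_eq_square)
    qed
    finally show ?thesis by (simp add: x_def)
  qed
  have side: "(u \<bullet> m_hat p i) * side_integral p i (G u) + (v \<bullet> m_hat p i) * side_integral p i (G v)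
      = beta_side p u0 v0 w0 i" for i
  proof -
    define L where "L = ln (R_plus p u0 v0 w0 i + \<bar>w0\<bar>) - ln (R_minus p u0 v0 w0 i + \<bar>w0\<bar>)"
    have G: "side_integral p i (G e) = (s_hat p i \<bullet> e) * L + (m_hat p i \<bullet> e) * beta_side p u0 v0 w0 i"
      if "e \<bullet> w = 0" for e
      unfolding G_def[abs_def] h_def k_def L_def by (rule side_integral_solid_angle[OF that False])
    have "(u \<bullet> m_hat p i) * side_integral p i (G u) + (v \<bullet> m_hat p i) * side_integral p i (G v) =
        ((m_hat p i \<bullet> u) * (s_hat p i \<bullet> u) + (m_hat p i \<bullet> v) * (s_hat p i \<bullet> v)) * L
        + ((m_hat p i \<bullet> u) * (m_hat p i \<bullet> u) + (m_hat p i \<bullet> v) * (m_hat p i \<bullet> v)) * beta_side p u0 v0 w0 i"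
      using G[of u] G[of v] by (simp add: frame_products inner_commute[of _ "m_hat p i"] algebra_simps)
    then show ?thesis
      unfolding sum_frame[OF m_hat_facts(3)] by (simp add: m_hat_facts)
  qed
  have flux: "triangle_integral p (\<lambda>r. e \<bullet> G' e r) =
      (\<Sum>i\<in>UNIV. (e \<bullet> m_hat p i) * side_integral p i (G e))" if "e \<bullet> w = 0" for e
    by (intro triangle_divergence grad cont that)
  have "k * triangle_integral p (\<lambda>r. 1 / norm (r - r0) ^ 3) =
      triangle_integral p (\<lambda>r. u \<bullet> G' u r + v \<bullet> G' v r)"
    unfolding triangle_integral_scale[symmetric] by (rule triangle_integral_cong[OF div])
  also have "\<dots> = triangle_integral p (\<lambda>r. u \<bullet> G' u r) + triangle_integral p (\<lambda>r. v \<bullet> G' v r)"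
    by (intro triangle_integral_add continuous_intros cont)
  also have "\<dots> = (\<Sum>i\<in>UNIV. beta_side p u0 v0 w0 i)"
    unfolding flux[OF uw_frame(3)] flux[OF v_facts(3)] sum.distrib[symmetric] side ..
  finally have "k * triangle_integral p (\<lambda>r. 1 / norm (r - r0) ^ 3) = beta p u0 v0 w0"
    by (simp add: beta_def sum_3)
  then show ?thesis
    by (metis k_def mult.assoc mult_sgn_abs)
qed

lemma normal_derivative:
  assumes "r \<in> triangle p"
  shows "w \<bullet> grad (dipole_potential q r0) r =
    (q \<bullet> w) / norm (r - r0) ^ 3 - 3 * w0 * (q \<bullet> (r - r0)) / norm (r - r0) ^ 5"
  unfolding grad_dipole_potential[OF triangle_nonzero[OF assms]]
  by (subst inner_diff_right)
    (simp add: inner_commute[of w] triangle_height[OF assms] ac_simps)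

lemma continuous_normal_derivative:
  "continuous_on (triangle p) (\<lambda>r. w \<bullet> grad (dipole_potential q r0) r)"
proof -
  have "continuous_on (triangle p)
      (\<lambda>r. (q \<bullet> w) / norm (r - r0) ^ 3 - 3 * w0 * (q \<bullet> (r - r0)) / norm (r - r0) ^ 5)"
    by (auto intro!: continuous_intros dest: triangle_nonzero)
  then show ?thesis
    by (rule continuous_on_eq) (simp add: normal_derivative)
qed

lemma tangential_part: "(q - (q \<bullet> w) *\<^sub>R w) \<bullet> w = 0" "(q - (q \<bullet> w) *\<^sub>R w) \<bullet> m_hat p i = q \<bullet> m_hat p i"
  using m_hat_facts(3)[of i]
  by (simp_all add: inner_diff_left w_unit inner_commute[of w "m_hat p i"])

text \<open>
  For \<open>w0 = 0\<close> both sides vanish, whatever value the division by zero gives to \<open>Rs\<close>.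
\<close>

lemma w0_side_integral:
  "w0 * side_integral p i (\<lambda>r. 1 / norm (r - r0) ^ 3) = w0 * Rs p u0 v0 w0 i"
  using side_integral_inverse_cube[of i] by (cases "w0 = 0") (simp_all add: sum_power2_eq_zero_iff)

text \<open>
  Applied to the coordinates of the tangential part of \<open>R / norm R ^ 3\<close> in the basis \<open>u\<close>, \<open>v\<close>, the divergence
  theorem leaves on each side the constant component \<open>t\<close> of \<open>R\<close> along the normal.
\<close>

lemma I0_closed_form:
  "triangle_integral p (\<lambda>r. w \<bullet> grad (dipole_potential q r0) r) =
    (\<Sum>i\<in>UNIV. Rs p u0 v0 w0 i * (w0 * (q \<bullet> m_hat p i) - t i * (q \<bullet> w)))"
proof -
  define qt where "qt = q - (q \<bullet> w) *\<^sub>R w"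
  have qt: "qt \<bullet> w = 0" "\<And>i. qt \<bullet> m_hat p i = q \<bullet> m_hat p i"
    unfolding qt_def by (rule tangential_part)+
  have pointwise: "w \<bullet> grad (dipole_potential q r0) r =
      w0 * (qt \<bullet> grad_inverse_cube r) + (- (q \<bullet> w)) * (u \<bullet> grad_moment u r + v \<bullet> grad_moment v r)"
    if r: "r \<in> triangle p" for r
  proof -
    define x where "x = norm (r - r0)"
    have x: "x \<noteq> 0" using triangle_nonzero[OF r] by (simp add: x_def)
    \<comment> \<open>With all fractions written as multiples of \<open>z\<close>, what remains are polynomial identities.\<close>
    define z where "z = 1 / x ^ 5"
    have z: "a / x ^ 3 = a * (x\<^sup>2 * z)" "a / x ^ 5 = a * z" for a
      using x by (simp_all add: z_def eval_nat_numeral)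
    have 1: "qt \<bullet> grad_inverse_cube r = - 3 / x ^ 5 * (q \<bullet> (r - r0) - (q \<bullet> w) * w0)"
      unfolding grad_inverse_cube_def qt_def inner_scaleR_right inner_diff_left[of q] inner_scaleR_left x_def
        inner_commute[of w "r - r0"] triangle_height[OF r] ..
    have "u \<bullet> grad_moment u r + v \<bullet> grad_moment v r =
        2 / x ^ 3 + - 3 / x ^ 5 * (((r - r0) \<bullet> u)\<^sup>2 + ((r - r0) \<bullet> v)\<^sup>2)"
      unfolding grad_moment_def inner_add_right inner_scaleR_right frame_products x_def
        inner_commute[of u "r - r0"] inner_commute[of v "r - r0"]
      by (simp add: power2_eq_square distrib_left)
    also have "\<dots> = 2 / x ^ 3 + - 3 / x ^ 5 * (x\<^sup>2 - w0\<^sup>2)"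
      unfolding planar_norm[OF r] x_def[symmetric] ..
    finally have 2: "u \<bullet> grad_moment u r + v \<bullet> grad_moment v r = 2 / x ^ 3 + - 3 / x ^ 5 * (x\<^sup>2 - w0\<^sup>2)" .
    show ?thesis
      unfolding normal_derivative[OF r] x_def[symmetric] 1 2 z
      by (simp add: algebra_simps power2_eq_square)
  qed
  have side: "(u \<bullet> m_hat p i) * side_integral p i (\<lambda>r. (r - r0) \<bullet> u * (1 / norm (r - r0) ^ 3))
      + (v \<bullet> m_hat p i) * side_integral p i (\<lambda>r. (r - r0) \<bullet> v * (1 / norm (r - r0) ^ 3))
      = t i * Rs p u0 v0 w0 i" for i
  proof -
    note S = side_integral_moment[of u i, OF uw_frame(3)] side_integral_moment[of v i, OF v_facts(3)]
    have "(u \<bullet> m_hat p i) * side_integral p i (\<lambda>r. (r - r0) \<bullet> u * (1 / norm (r - r0) ^ 3))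
      + (v \<bullet> m_hat p i) * side_integral p i (\<lambda>r. (r - r0) \<bullet> v * (1 / norm (r - r0) ^ 3)) =
        ((m_hat p i \<bullet> u) * (s_hat p i \<bullet> u) + (m_hat p i \<bullet> v) * (s_hat p i \<bullet> v)) * Rd p u0 v0 w0 i
        + ((m_hat p i \<bullet> u) * (m_hat p i \<bullet> u) + (m_hat p i \<bullet> v) * (m_hat p i \<bullet> v)) * (t i * Rs p u0 v0 w0 i)"
      unfolding S by (simp add: inner_commute[of _ "m_hat p i"] algebra_simps)
    then show ?thesis
      unfolding sum_frame[OF m_hat_facts(3)] by (simp add: m_hat_facts)
  qed
  have "triangle_integral p (\<lambda>r. w \<bullet> grad (dipole_potential q r0) r) =
      triangle_integral p (\<lambda>r. w0 * (qt \<bullet> grad_inverse_cube r)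
        + (- (q \<bullet> w)) * (u \<bullet> grad_moment u r + v \<bullet> grad_moment v r))"
    by (rule triangle_integral_cong[OF pointwise])
  also have "\<dots> = w0 * triangle_integral p (\<lambda>r. qt \<bullet> grad_inverse_cube r) +
      (- (q \<bullet> w)) * (triangle_integral p (\<lambda>r. u \<bullet> grad_moment u r) + triangle_integral p (\<lambda>r. v \<bullet> grad_moment v r))"
    unfolding triangle_integral_scale[symmetric]
    by (subst triangle_integral_add, (intro continuous_intros field_continuous)+)
      (subst triangle_integral_scale, subst triangle_integral_add,
        (intro continuous_intros field_continuous)+, simp add: triangle_integral_scale)
  also have "\<dots> = (\<Sum>i\<in>UNIV. (q \<bullet> m_hat p i) * (w0 * side_integral p i (\<lambda>r. 1 / norm (r - r0) ^ 3)))
      - (q \<bullet> w) * (\<Sum>i\<in>UNIV. t i * Rs p u0 v0 w0 i)"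
    unfolding field_flux(1)[OF qt(1)]
      field_flux(3)[OF uw_frame(3)]
      field_flux(3)[OF v_facts(3)]
      sum.distrib[symmetric] side qt(2)
    by (simp add: sum_distrib_left sum_negf mult.left_commute)
  finally show ?thesis
    unfolding w0_side_integral by (simp add: sum_3 algebra_simps)
qed

lemma moment_closed_form:
  assumes e: "e \<bullet> w = 0"
  shows "triangle_integral p (\<lambda>r. ((r - r0) \<bullet> e) * (w \<bullet> grad (dipole_potential q r0) r)) =
    w0 * (\<Sum>i\<in>UNIV. (q \<bullet> m_hat p i) *
      ((s_hat p i \<bullet> e) * Rd p u0 v0 w0 i + (m_hat p i \<bullet> e) * (t i * Rs p u0 v0 w0 i)))
    - (q \<bullet> e) * (sgn w0 * beta p u0 v0 w0)
    + (q \<bullet> w) * (\<Sum>i\<in>UNIV. (e \<bullet> m_hat p i) * (Rs p u0 v0 w0 i * w0\<^sup>2 - f2 p u0 v0 w0 i))"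
proof -
  define qt where "qt = q - (q \<bullet> w) *\<^sub>R w"
  have qt: "qt \<bullet> w = 0" "\<And>i. qt \<bullet> m_hat p i = q \<bullet> m_hat p i"
    unfolding qt_def by (rule tangential_part)+
  have pointwise: "((r - r0) \<bullet> e) * (w \<bullet> grad (dipole_potential q r0) r) =
      (w0 * (qt \<bullet> grad_moment e r) + (- (q \<bullet> e) * w0) * (1 / norm (r - r0) ^ 3))
      + (((q \<bullet> w) * w0\<^sup>2) * (e \<bullet> grad_inverse_cube r) + (- (q \<bullet> w)) * (e \<bullet> grad_inverse r))"
    if r: "r \<in> triangle p" for r
  proof -
    define x where "x = norm (r - r0)"
    define y where "y = (r - r0) \<bullet> e"
    have x: "x \<noteq> 0" using triangle_nonzero[OF r] by (simp add: x_def)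
    have "qt \<bullet> (r - r0) = q \<bullet> (r - r0) - (q \<bullet> w) * w0"
      using triangle_height[OF r] by (simp only: qt_def inner_diff_left inner_scaleR_left inner_commute[of w "r - r0"])
    moreover have "qt \<bullet> e = q \<bullet> e"
      using e by (simp add: qt_def inner_diff_left inner_commute[of w e])
    ultimately have 1: "qt \<bullet> grad_moment e r =
        (q \<bullet> e) / x ^ 3 + - 3 / x ^ 5 * y * (q \<bullet> (r - r0) - (q \<bullet> w) * w0)"
      unfolding grad_moment_def inner_add_right inner_scaleR_right x_def y_def by simp
    have 2: "e \<bullet> grad_inverse_cube r = - 3 / x ^ 5 * y" "e \<bullet> grad_inverse r = - 1 / x ^ 3 * y"
      unfolding grad_inverse_cube_def grad_inverse_def inner_scaleR_right x_def y_def
        inner_commute[of e "r - r0"]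
      by simp_all
    define z where "z = 1 / x ^ 5"
    have z: "a / x ^ 3 = a * (x\<^sup>2 * z)" "a / x ^ 5 = a * z" for a
      using x by (simp_all add: z_def eval_nat_numeral)
    show ?thesis
      unfolding normal_derivative[OF r] x_def[symmetric] y_def[symmetric] 1 2 z
      by (simp add: algebra_simps power2_eq_square)
  qed
  have "triangle_integral p (\<lambda>r. ((r - r0) \<bullet> e) * (w \<bullet> grad (dipole_potential q r0) r)) =
      triangle_integral p (\<lambda>r. (w0 * (qt \<bullet> grad_moment e r) + (- (q \<bullet> e) * w0) * (1 / norm (r - r0) ^ 3))
      + (((q \<bullet> w) * w0\<^sup>2) * (e \<bullet> grad_inverse_cube r) + (- (q \<bullet> w)) * (e \<bullet> grad_inverse r)))"
    by (rule triangle_integral_cong[OF pointwise])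
  also have "\<dots> = (triangle_integral p (\<lambda>r. w0 * (qt \<bullet> grad_moment e r))
        + triangle_integral p (\<lambda>r. (- (q \<bullet> e) * w0) * (1 / norm (r - r0) ^ 3)))
      + (triangle_integral p (\<lambda>r. ((q \<bullet> w) * w0\<^sup>2) * (e \<bullet> grad_inverse_cube r))
        + triangle_integral p (\<lambda>r. (- (q \<bullet> w)) * (e \<bullet> grad_inverse r)))"
    by (simp only: triangle_integral_add continuous_on_add continuous_on_mult_left continuous_on_inner
        continuous_on_const field_continuous)
  also have "\<dots> = w0 * triangle_integral p (\<lambda>r. qt \<bullet> grad_moment e r)
      - (q \<bullet> e) * (w0 * triangle_integral p (\<lambda>r. 1 / norm (r - r0) ^ 3))
      + (q \<bullet> w) * (w0\<^sup>2 * triangle_integral p (\<lambda>r. e \<bullet> grad_inverse_cube r) - triangle_integral p (\<lambda>r. e \<bullet> grad_inverse r))"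
    unfolding triangle_integral_scale by (simp add: algebra_simps)
  also have "w0\<^sup>2 * triangle_integral p (\<lambda>r. e \<bullet> grad_inverse_cube r) - triangle_integral p (\<lambda>r. e \<bullet> grad_inverse r) =
      w0\<^sup>2 * (\<Sum>i\<in>UNIV. (e \<bullet> m_hat p i) * side_integral p i (\<lambda>r. 1 / norm (r - r0) ^ 3))
      - (\<Sum>i\<in>UNIV. (e \<bullet> m_hat p i) * f2 p u0 v0 w0 i)"
    unfolding field_flux(1)[OF e]
      field_flux(2)[OF e] side_integral_inverse ..
  also have "\<dots> = (\<Sum>i\<in>UNIV. (e \<bullet> m_hat p i) * (w0 * (w0 * side_integral p i (\<lambda>r. 1 / norm (r - r0) ^ 3))
      - f2 p u0 v0 w0 i))"
    by (simp add: sum_3 algebra_simps power2_eq_square)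
  moreover have "w0 * (w0 * c) = c * w0\<^sup>2" for c by (simp add: power2_eq_square)
  ultimately show ?thesis
    unfolding field_flux(3)[OF qt(1)] qt(2) side_integral_moment[OF e]
      triangle_integral_inverse_cube w0_side_integral
    by simp
qed

end

section \<open>Linear interpolation and the source vector\<close>

text \<open>
  The point is written as the midpoint of two points, one on each of the lines from \<open>p 1\<close> through the
  other vertices, which avoids dividing by \<open>a + b\<close>.
\<close>

lemma linear_interpolation_barycentric:
  assumes "linear_interpolation p \<phi>"
  shows "\<phi> (triangle_param p (a, b)) = vector [1 - a - b, a, b]"
proof -
  let ?S = "affine hull {p 1, p 2, p 3}"
  define y1 where "y1 = (1 - 2 * a) *\<^sub>R p 1 + (2 * a) *\<^sub>R p 2"
  define y2 where "y2 = (1 - 2 * b) *\<^sub>R p 1 + (2 * b) *\<^sub>R p 3"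
  have mid: "triangle_param p (a, b) = (1 - 1/2) *\<^sub>R y1 + (1/2) *\<^sub>R y2"
    by (simp add: triangle_param_def y1_def y2_def algebra_simps flip: scaleR_add_left)
  have p: "p 1 \<in> ?S" "p 2 \<in> ?S" "p 3 \<in> ?S" by (simp_all add: hull_inc)
  then have y: "y1 \<in> ?S" "y2 \<in> ?S"
    unfolding y1_def y2_def by (intro mem_affine[OF affine_affine_hull]; simp)+
  have aff: "\<phi> ((1 - t) *\<^sub>R x + t *\<^sub>R y) $ i = (1 - t) * (\<phi> x $ i) + t * (\<phi> y $ i)"
    if "x \<in> ?S" "y \<in> ?S" for x y t i
    using assms that unfolding linear_interpolation_def affine_fun_on_def by blast
  have delta: "\<phi> (p j) $ i = (if i = j then 1 else 0)" for i j
    using assms by (simp add: linear_interpolation_def)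
  have "\<phi> (triangle_param p (a, b)) $ i =
      (1 - a - b) * (\<phi> (p 1) $ i) + a * (\<phi> (p 2) $ i) + b * (\<phi> (p 3) $ i)" for i
    unfolding mid aff[OF y] unfolding y1_def y2_def aff[OF p(1,2)] aff[OF p(1,3)]
    by (simp add: field_simps)
  then show ?thesis
    by (simp add: vec_eq_iff forall_3 delta vector_3)
qed

lemma (in triangle_frame) interpolation_uv:
  assumes "linear_interpolation p \<phi>" "r \<in> triangle p"
  shows "\<phi> r = phi_uv p a b + (u_coord p r - a) *\<^sub>R column 1 (interp_matrix p)
    + (v_coord p r - b) *\<^sub>R column 2 (interp_matrix p)"
proof -
  obtain x y where r: "r = triangle_param p (x, y)"
    using assms unfolding triangle_param_image[symmetric] by auto
  have d: "r - p 1 = x *\<^sub>R side_vec p 3 - y *\<^sub>R side_vec p 2"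
    by (simp add: r triangle_param_def side_vec_expand algebra_simps)
  have uv: "u_coord p r = x * l 3 + y * u3 p" "v_coord p r = y * v3 p"
    unfolding u_coord_def v_coord_def d side_vec_uv using uw_frame v_facts
    by (simp_all add: inner_add_left inner_diff_left inner_commute algebra_simps)
  show ?thesis
    unfolding r linear_interpolation_barycentric[OF assms(1)] unfolding uv[unfolded r]
    using side_len_pos[of 3] v3_pos
    by (simp add: vec_eq_iff forall_3 vector_3 phi_uv_def interp_matrix_def Let_def column_def
        matrix_vector_mult_def sum_3 vector_2 field_simps)
qed

theorem mainTheorem1:
  fixes p :: "3 \<Rightarrow> real^3" and r0 q \<rho> :: "real^3" and u0 v0 w0 :: real
    and \<phi> :: "real^3 \<Rightarrow> real^3" and I0 Iu Iv :: real
  assumes nondegenerate: "\<not> collinear {p 1, p 2, p 3}"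
    and source: "r0 \<notin> triangle p"
    and rho: "\<rho> = p 1 + u0 *\<^sub>R u_hat p + v0 *\<^sub>R v_hat p"
    and r0: "r0 = \<rho> - w0 *\<^sub>R w_hat p"
    and phi: "linear_interpolation p \<phi>"
    and I0: "I0 = triangle_integral p
               (\<lambda>r. w_hat p \<bullet> grad (dipole_potential q r0) r)"
    and Iu: "Iu = triangle_integral p
               (\<lambda>r. (u_coord p r - u0) * (w_hat p \<bullet> grad (dipole_potential q r0) r))"
    and Iv: "Iv = triangle_integral p
               (\<lambda>r. (v_coord p r - v0) * (w_hat p \<bullet> grad (dipole_potential q r0) r))"
  shows "(4 * pi) *\<^sub>R source_vector p \<phi> q r0 =
           I0 *\<^sub>R phi_uv p u0 v0 + interp_matrix p *v vector [Iu, Iv]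
       \<and> I0 = q \<bullet> (\<Sum>i\<in>UNIV. Rs p u0 v0 w0 i *\<^sub>R
                 (w0 *\<^sub>R m_hat p i - t0 p u0 v0 i *\<^sub>R w_hat p))
       \<and> Iu = q \<bullet> (w0 *\<^sub>R (\<Sum>i\<in>UNIV.
                   (u_hat p \<bullet> (Rd p u0 v0 w0 i *\<^sub>R s_hat p i
                      + Rs p u0 v0 w0 i *\<^sub>R t0_vec p u0 v0 i)) *\<^sub>R m_hat p i)
                 - (sgn w0 * beta p u0 v0 w0) *\<^sub>R u_hat p
                 + (u_hat p \<bullet> (\<Sum>i\<in>UNIV.
                      (Rs p u0 v0 w0 i * w0\<^sup>2 - f2 p u0 v0 w0 i) *\<^sub>R m_hat p i)) *\<^sub>R w_hat p)
       \<and> Iv = q \<bullet> (w0 *\<^sub>R (\<Sum>i\<in>UNIV.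
                   (v_hat p \<bullet> (Rd p u0 v0 w0 i *\<^sub>R s_hat p i
                      + Rs p u0 v0 w0 i *\<^sub>R t0_vec p u0 v0 i)) *\<^sub>R m_hat p i)
                 - (sgn w0 * beta p u0 v0 w0) *\<^sub>R v_hat p
                 + (v_hat p \<bullet> (\<Sum>i\<in>UNIV.
                      (Rs p u0 v0 w0 i * w0\<^sup>2 - f2 p u0 v0 w0 i) *\<^sub>R m_hat p i)) *\<^sub>R w_hat p)"
proof -
  interpret triangle_source p r0 u0 v0 w0
    by unfold_locales (fact nondegenerate, fact source, simp only: rho r0)
  define h where "h r = w_hat p \<bullet> grad (dipole_potential q r0) r" for r
  have h: "continuous_on (triangle p) h"
    unfolding h_def[abs_def] by (rule continuous_normal_derivative)
  have shift: "r - r0 = (r - p 1) - u0 *\<^sub>R u - v0 *\<^sub>R v + w0 *\<^sub>R w" for r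
    by (simp add: source_coords)
  have coords: "u_coord p r - u0 = (r - r0) \<bullet> u" "v_coord p r - v0 = (r - r0) \<bullet> v" for r
    unfolding u_coord_def v_coord_def shift inner_add_left
      inner_diff_left[of _ "u0 *\<^sub>R u"] inner_diff_left[of _ "v0 *\<^sub>R v"]
    by (simp_all add: frame_products)
  have moments: "continuous_on (triangle p) (\<lambda>r. (u_coord p r - u0) * h r)"
    "continuous_on (triangle p) (\<lambda>r. (v_coord p r - v0) * h r)"
    unfolding coords by (intro continuous_intros h)+
  have "(4 * pi) *\<^sub>R source_vector p \<phi> q r0 =
      triangle_integral p (\<lambda>r. (grad (dipole_potential q r0) r \<bullet> w_hat p) *\<^sub>R \<phi> r)"
    by (simp add: source_vector_def)
  also have "\<dots> = triangle_integral p (\<lambda>r. h r *\<^sub>R phi_uv p u0 v0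
      + (((u_coord p r - u0) * h r) *\<^sub>R column 1 (interp_matrix p)
      + ((v_coord p r - v0) * h r) *\<^sub>R column 2 (interp_matrix p)))"
    by (rule triangle_integral_cong, subst interpolation_uv[OF phi, of _ u0 v0], assumption)
      (simp add: h_def inner_commute[of w] scaleR_add_right mult.commute)
  also have "\<dots> = triangle_integral p h *\<^sub>R phi_uv p u0 v0
      + (triangle_integral p (\<lambda>r. (u_coord p r - u0) * h r) *\<^sub>R column 1 (interp_matrix p)
      + triangle_integral p (\<lambda>r. (v_coord p r - v0) * h r) *\<^sub>R column 2 (interp_matrix p))"
    by (simp only: triangle_integral_add triangle_integral_scaleR_left continuous_on_add
        continuous_on_scaleR continuous_on_const h moments)
  also have "\<dots> = I0 *\<^sub>R phi_uv p u0 v0 + interp_matrix p *v vector [Iu, Iv]"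
    unfolding I0 Iu Iv h_def[abs_def] matrix_mult_sum by (simp add: sum_2 vector_2 scalar_mult_eq_scaleR)
  finally have "(4 * pi) *\<^sub>R source_vector p \<phi> q r0 =
    I0 *\<^sub>R phi_uv p u0 v0 + interp_matrix p *v vector [Iu, Iv]" .
  moreover have "I0 = q \<bullet> (\<Sum>i\<in>UNIV. Rs p u0 v0 w0 i *\<^sub>R
      (w0 *\<^sub>R m_hat p i - t0 p u0 v0 i *\<^sub>R w_hat p))"
    unfolding I0 I0_closed_form by (simp add: inner_sum_right inner_diff_right)
  moreover have expand: "triangle_integral p (\<lambda>r. ((r - r0) \<bullet> e) * (w \<bullet> grad (dipole_potential q r0) r)) =
      q \<bullet> (w0 *\<^sub>R (\<Sum>i\<in>UNIV. (e \<bullet> (Rd p u0 v0 w0 i *\<^sub>R s_hat p i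
          + Rs p u0 v0 w0 i *\<^sub>R t0_vec p u0 v0 i)) *\<^sub>R m_hat p i)
        - (sgn w0 * beta p u0 v0 w0) *\<^sub>R e
        + (e \<bullet> (\<Sum>i\<in>UNIV. (Rs p u0 v0 w0 i * w0\<^sup>2 - f2 p u0 v0 w0 i) *\<^sub>R m_hat p i)) *\<^sub>R w)"
    if "e \<bullet> w = 0" for e
    unfolding moment_closed_form[OF that] t0_vec_def
    by (simp add: inner_sum_right inner_add_right inner_diff_right inner_commute[of e "s_hat p _"]
        inner_commute[of e "m_hat p _"] mult.commute mult.left_commute)
  ultimately show ?thesis
    unfolding Iu Iv coords using expand[OF uw_frame(3)] expand[OF v_facts(3)] by simp
qed

end
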